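(* Let $0<p\le\frac12$, let $n$ be a positive integer, let $f:(\{0,1\}^n,\mu_p^n)\to\{0,1\}$ be an increasing function with $\alpha=\int f\,d\mu_p^n>0$, and let $\epsilon>0$ be a constant. Then there exists a subset $S\subseteq[n]$ with $|S|\le e^{10^{12}\lceil I_f\rceil^2\alpha^{-2}\epsilon^{-2}}$ such that $$\mathbb{E}\left[f(x)\mid x_S=(1,\ldots,1)\right]\ge 1-\epsilon,$$ where $x$ is a random variable taking values in $\{0,1\}^n$ distributed according to $\mu_p^n$.
   Context: $\mu_p$ is the Bernoulli distribution on $\{0,1\}$ with $\mu_p(\{1\})=p$, $\mu_p(\{0\})=1-p$, and $\mu_p^n$ is the product measure on $\{0,1\}^n$. $[n]=\{1,\dots,n\}$, and $x_S=(x_i)_{i\in S}$. A function $f:\{0,1\}^n\to\{0,1\}$ is increasing if $f(x)\le f(y)$ whenever $x_i\le y_i$ for all $i\in[n]$. For $j\in[n]$, $I_f(j)=\Pr[f(x_1,\dots,x_n)\ne f(x_1,\dots,x_{j-1},y_j,x_{j+1},\dots,x_n)]$ with $x_1,\dots,x_n,y_1,\dots,y_n$ i.i.d. with law $\mu_p$; the total influence is $I_f=\sum_{j=1}^nI_f(j)$. *)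

theory Defs
  imports "HOL-Probability.Probability"
begin

text \<open>
  The values 0 and 1 are rendered as \<^const>\<open>False\<close> and \<^const>\<open>True\<close>, and a point of the
  n-dimensional cube as a function on \<^typ>\<open>nat\<close> that is \<^const>\<open>False\<close> outside \<open>{1..n}\<close>,
  which is the convention of \<^const>\<open>Pi_pmf\<close> with default value \<^const>\<open>False\<close>.
\<close>

definition cube :: "nat \<Rightarrow> (nat \<Rightarrow> bool) set" where
  "cube n = PiE_dflt {1..n} False (\<lambda>_. UNIV)"

definition mu :: "nat \<Rightarrow> real \<Rightarrow> (nat \<Rightarrow> bool) pmf" where
  "mu n p = Pi_pmf {1..n} False (\<lambda>_. bernoulli_pmf p)"

definition increasing_on_cube :: "nat \<Rightarrow> ((nat \<Rightarrow> bool) \<Rightarrow> bool) \<Rightarrow> bool" where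
  "increasing_on_cube n f \<longleftrightarrow>
     (\<forall>x\<in>cube n. \<forall>y\<in>cube n. (\<forall>i\<in>{1..n}. x i \<le> y i) \<longrightarrow> f x \<le> f y)"

text \<open>
  Only the coordinate \<open>j\<close> of the independent copy \<open>y\<close> is used: coordinate \<open>j\<close> is
  re-randomised, not flipped.
\<close>

definition influence :: "nat \<Rightarrow> real \<Rightarrow> ((nat \<Rightarrow> bool) \<Rightarrow> bool) \<Rightarrow> nat \<Rightarrow> real" where
  "influence n p f j =
     measure_pmf.prob (pair_pmf (mu n p) (mu n p)) {(x, y). f x \<noteq> f (x(j := y j))}"

definition total_influence :: "nat \<Rightarrow> real \<Rightarrow> ((nat \<Rightarrow> bool) \<Rightarrow> bool) \<Rightarrow> real" where
  "total_influence n p f = (\<Sum>j=1..n. influence n p f j)"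

end

theory Submission
  imports Defs
begin

text \<open>
  Low total influence puts almost all Fourier mass of f on sets of size at most
  \<open>k = O(I / (\<alpha> \<epsilon>))\<close>. Call a small set S active if planting ones on S makes the Fourier mass above S
  large. For a coordinate j, the part of f carried by sets containing no active set
  through j has small generalised influences, so hypercontractivity for global functions bounds its
  fourth moment uniformly in p; pairing it with the j-th difference of f, which takes few values, shows
  that its mass is a small multiple of the influence of j. So f is close to its Fourier
  truncation h to unions of active sets. Parseval makes active sets sparse, and after adding
  the sets contained in too many such unions (heavy sets), h is close to a function v of
  the core J(x), the union of all heavy sets on which x is identically 1, and
  J(x) is bounded on average. If no bounded S were as required, then on each atom of J with
  bounded core C the mean of f would be below \<open>1 - \<epsilon>\<close>, because by Harris it is at most the
  mean of f given \<open>x\<^sub>C = 1\<close>; then no function of J could be close to the Boolean function f.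
\<close>

section \<open>The biased cube\<close>

text \<open>The distance to beat is \<open>\<epsilon> * \<alpha> / 2\<close>. On an atom where F has
  mean m at most 1 - \<epsilon>, every constant has mean squared distance at least m * (1 - m),
  hence at least \<epsilon> * m, from F. Summed over the atoms with bounded core this is at least
  \<epsilon> times the part of \<alpha> that they carry, and Markov's inequality for the size of the
  core leaves them at least half of \<alpha>. Heavy sets are needed because sparsity of the covered
  sets only bounds how many of them lie in x on average: planting a single small V can make many of
  them appear at once, and then replacing their indicators by means is inaccurate. Such V are put
  into the core; for all others the conditional count is below \<eta>. The square in the exponent
  arises because a covered set is a union of up to k active sets and each of them costs a factor
  exponential in k, the activity threshold \<delta> being itself exponentially small in k. The
  weight of all covered sets is therefore only bounded by 2 to a multiple of k squared, and so is
  the core.\<close>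

locale biased =
  fixes p :: real
  assumes p_pos: "0 < p" and p_le: "p \<le> 1 / 2"
begin

definition wt :: "'a set \<Rightarrow> 'a set \<Rightarrow> real" where
  "wt N X = p ^ card X * (1 - p) ^ card (N - X)"

definition EE :: "'a set \<Rightarrow> ('a set \<Rightarrow> real) \<Rightarrow> real" where
  "EE N F = (\<Sum>X\<in>Pow N. wt N X * F X)"

definition s :: real where "s = p * (1 - p)"

text \<open>
  The characters are left unnormalised: \<open>phi T\<close> has second moment \<open>s ^ card T\<close>, so the squared
  Fourier coefficient of \<open>poly N a\<close> at \<open>T\<close> is \<open>s ^ card T * (a T)\<^sup>2\<close>.
\<close>

definition phi :: "'a set \<Rightarrow> 'a set \<Rightarrow> real" where
  "phi T X = (\<Prod>i\<in>T. of_bool (i \<in> X) - p)"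

definition poly :: "'a set \<Rightarrow> ('a set \<Rightarrow> real) \<Rightarrow> 'a set \<Rightarrow> real" where
  "poly N a X = (\<Sum>T\<in>Pow N. a T * phi T X)"

definition deriv :: "'a \<Rightarrow> ('a set \<Rightarrow> real) \<Rightarrow> 'a set \<Rightarrow> real" where
  "deriv j F X = F (insert j X) - F (X - {j})"

lemma s_pos: "0 < s"
  using p_pos p_le by (simp add: s_def)

lemma s_le_p: "s \<le> p"
  using p_pos p_le by (simp add: s_def)

lemma p_le_2s: "p \<le> 2 * s"
proof -
  have "p * 1 \<le> p * (2 * (1 - p))"
    using p_pos p_le by (intro mult_left_mono) auto
  then show ?thesis by (simp add: s_def algebra_simps)
qed

lemma wt_pos: "0 < wt N X"
  using p_pos p_le by (simp add: wt_def)

lemma sum_Pow_insert: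
  fixes g :: "'a set \<Rightarrow> real"
  assumes "finite N" "i \<notin> N"
  shows "(\<Sum>X\<in>Pow (insert i N). g X) = (\<Sum>X\<in>Pow N. g X + g (insert i X))"
proof -
  have "(\<Sum>X\<in>Pow (insert i N). g X) = (\<Sum>X\<in>Pow N. g X) + (\<Sum>X\<in>insert i ` Pow N. g X)"
    unfolding Pow_insert using assms by (intro sum.union_disjoint) auto
  also have "(\<Sum>X\<in>insert i ` Pow N. g X) = (\<Sum>X\<in>Pow N. g (insert i X))"
    using assms(2) by (subst sum.reindex) (auto simp: inj_on_def insert_eq_iff)
  finally show ?thesis by (simp add: sum.distrib)
qed

lemma EE_empty [simp]: "EE {} F = F {}"
  by (simp add: EE_def wt_def)

lemma EE_insert:
  assumes "finite N" "i \<notin> N"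
  shows "EE (insert i N) F = EE N (\<lambda>X. (1 - p) * F X + p * F (insert i X))"
proof -
  have "wt (insert i N) X = (1 - p) * wt N X" "wt (insert i N) (insert i X) = p * wt N X"
    if "X \<in> Pow N" for X
  proof -
    have fin: "finite X" "i \<notin> X" using that assms finite_subset by auto
    have "insert i N - X = insert i (N - X)" "insert i N - insert i X = N - X"
      using fin assms by auto
    then show "wt (insert i N) X = (1 - p) * wt N X"
      "wt (insert i N) (insert i X) = p * wt N X"
      using fin assms by (auto simp: wt_def)
  qed
  then show ?thesis
    unfolding EE_def sum_Pow_insert[OF assms] by (intro sum.cong) (simp_all add: distrib_left)
qed

lemma EE_cong: "(\<And>X. X \<subseteq> N \<Longrightarrow> F X = G X) \<Longrightarrow> EE N F = EE N G"
  by (auto simp: EE_def intro!: sum.cong)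

lemma EE_mono: "(\<And>X. X \<subseteq> N \<Longrightarrow> F X \<le> G X) \<Longrightarrow> EE N F \<le> EE N G"
  unfolding EE_def by (intro sum_mono mult_left_mono) (auto simp: less_imp_le[OF wt_pos])

lemma EE_nonneg: "(\<And>X. X \<subseteq> N \<Longrightarrow> 0 \<le> F X) \<Longrightarrow> 0 \<le> EE N F"
  unfolding EE_def by (intro sum_nonneg mult_nonneg_nonneg) (auto simp: less_imp_le[OF wt_pos])

lemma EE_add: "EE N (\<lambda>X. F X + G X) = EE N F + EE N G"
  by (simp add: EE_def sum.distrib algebra_simps)

lemma EE_diff: "EE N (\<lambda>X. F X - G X) = EE N F - EE N G"
  by (simp add: EE_def sum_subtractf algebra_simps)

lemma EE_cmult: "EE N (\<lambda>X. c * F X) = c * EE N F"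
  by (simp add: EE_def sum_distrib_left algebra_simps)

lemma EE_linear: "EE N (\<lambda>X. a * F X + b * G X) = a * EE N F + b * EE N G"
  by (simp add: EE_add EE_cmult)

lemma EE_sum: "EE N (\<lambda>X. \<Sum>i\<in>A. F i X) = (\<Sum>i\<in>A. EE N (F i))"
  unfolding EE_def by (subst sum.swap) (simp add: sum_distrib_left)

lemma EE_const: "finite N \<Longrightarrow> EE N (\<lambda>X. c) = c"
proof (induction N arbitrary: c rule: finite_induct)
  case (insert i N)
  then show ?case by (simp add: EE_insert algebra_simps)
qed simp

text \<open>Averages over coordinate j first but keeps the ground set N, so that later arguments
  never have to split N.\<close>

lemma EE_remove:
  assumes "finite N" "j \<in> N"
  shows "EE N F = EE N (\<lambda>X. (1 - p) * F (X - {j}) + p * F (insert j X))"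
proof -
  define M where "M = N - {j}"
  have M: "finite M" "j \<notin> M" "N = insert j M" using assms by (auto simp: M_def)
  show ?thesis
    unfolding M(3) EE_insert[OF M(1,2)]
  proof (intro EE_cong)
    fix X assume "X \<subseteq> M"
    then have "X - {j} = X" using M by auto
    then show "(1 - p) * F X + p * F (insert j X) =
      (1 - p) * ((1 - p) * F (X - {j}) + p * F (insert j X)) +
      p * ((1 - p) * F (insert j X - {j}) + p * F (insert j (insert j X)))"
      by (simp add: algebra_simps)
  qed
qed

text \<open>A random point conditioned to contain S has the law of \<open>X \<union> S\<close>.
  Conditioning on ones is therefore written as planting everywhere, without division.\<close>

lemma EE_superset:
  assumes "finite N" "S \<subseteq> N"
  shows "EE N (\<lambda>X. of_bool (S \<subseteq> X) * F X) = p ^ card S * EE N (\<lambda>X. F (X \<union> S))"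
proof -
  have "finite S" using assms finite_subset by blast
  then show ?thesis using assms(2)
  proof (induction S arbitrary: F rule: finite_induct)
    case (insert j S)
    have "EE N (\<lambda>X. of_bool (insert j S \<subseteq> X) * F X) =
        EE N (\<lambda>X. of_bool (S \<subseteq> X) * (of_bool (j \<in> X) * F X))"
      by (intro EE_cong) auto
    also have "\<dots> = p ^ card S * EE N (\<lambda>X. of_bool (j \<in> X \<union> S) * F (X \<union> S))"
      using insert by simp
    also have "EE N (\<lambda>X. of_bool (j \<in> X \<union> S) * F (X \<union> S)) = p * EE N (\<lambda>X. F (insert j X \<union> S))"
      using insert by (subst EE_remove[where j = j]) (auto simp: assms EE_cmult[symmetric])
    finally show ?case using insert by (simp add: Un_insert_right mult_ac)
  qed simp
qed

lemma harris:
  assumes "finite N"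
    and "\<And>X Y. X \<subseteq> Y \<Longrightarrow> Y \<subseteq> N \<Longrightarrow> F X \<le> F Y"
    and "\<And>X Y. X \<subseteq> Y \<Longrightarrow> Y \<subseteq> N \<Longrightarrow> G Y \<le> G X"
  shows "EE N (\<lambda>X. F X * G X) \<le> EE N F * EE N G"
  using assms
proof (induction N arbitrary: F G rule: finite_induct)
  case (insert i N)
  let ?F1 = "\<lambda>X. F (insert i X)" and ?G1 = "\<lambda>X. G (insert i X)"
  have 0: "EE N (\<lambda>X. F X * G X) \<le> EE N F * EE N G"
    by (rule insert.IH; rule insert.prems; auto)
  have 1: "EE N (\<lambda>X. ?F1 X * ?G1 X) \<le> EE N ?F1 * EE N ?G1"
    by (rule insert.IH; rule insert.prems; auto)
  have f: "EE N F \<le> EE N ?F1"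
    by (rule EE_mono; rule insert.prems; auto)
  have g: "EE N ?G1 \<le> EE N G"
    by (rule EE_mono; rule insert.prems; auto)
  \<comment> \<open>This is minus the covariance, over coordinate i alone, of the conditional means
    of F and G.\<close>
  have "p * (1 - p) * ((EE N ?F1 - EE N F) * (EE N G - EE N ?G1)) \<ge> 0"
    using f g p_pos p_le by (intro mult_nonneg_nonneg) auto
  then have "(1 - p) * (EE N F * EE N G) + p * (EE N ?F1 * EE N ?G1) \<le>
      ((1 - p) * EE N F + p * EE N ?F1) * ((1 - p) * EE N G + p * EE N ?G1)"
    by (simp add: algebra_simps)
  moreover have "(1 - p) * EE N (\<lambda>X. F X * G X) + p * EE N (\<lambda>X. ?F1 X * ?G1 X) \<le>
      (1 - p) * (EE N F * EE N G) + p * (EE N ?F1 * EE N ?G1)"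
    using 0 1 p_pos p_le by (intro add_mono mult_left_mono) auto
  ultimately show ?case
    using insert.hyps by (simp add: EE_insert EE_add EE_cmult)
qed simp

section \<open>Characters, Fourier expansion and Parseval\<close>

lemma phi_insert_left:
  "finite T \<Longrightarrow> i \<notin> T \<Longrightarrow> phi (insert i T) X = (of_bool (i \<in> X) - p) * phi T X"
  by (simp add: phi_def)

lemma phi_insert_right: "i \<notin> T \<Longrightarrow> phi T (insert i X) = phi T X"
  unfolding phi_def by (intro prod.cong) auto

lemma poly_empty [simp]: "poly {} a X = a {}"
  by (simp add: poly_def phi_def)

lemma poly_insert:
  assumes "finite N" "i \<notin> N"
  shows "poly (insert i N) a X =
    poly N a X + (of_bool (i \<in> X) - p) * poly N (\<lambda>T. a (insert i T)) X"
proof -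
  have "phi (insert i T) X = (of_bool (i \<in> X) - p) * phi T X" if "T \<in> Pow N" for T
    using that assms finite_subset by (intro phi_insert_left) auto
  then show ?thesis
    unfolding poly_def sum_Pow_insert[OF assms]
    by (simp add: sum.distrib sum_distrib_left mult_ac)
qed

lemma poly_insert_right: "i \<notin> N \<Longrightarrow> poly N a (insert i X) = poly N a X"
  unfolding poly_def by (intro sum.cong refl arg_cong2[where f = "(*)"] phi_insert_right) auto

text \<open>Averaging over coordinate i yields the coefficients of sets without i, and differencing
  in i those of sets through i.\<close>

lemma poly_expansion:
  assumes "finite N"
  shows "\<exists>a. \<forall>X\<subseteq>N. F X = poly N a X"
  using assms
proof (induction N arbitrary: F rule: finite_induct)
  case empty
  then show ?case by (auto intro: exI[of _ "\<lambda>_. F {}"])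
next
  case (insert i N)
  obtain a where a: "\<forall>X\<subseteq>N. (1 - p) * F X + p * F (insert i X) = poly N a X"
    using insert.IH[of "\<lambda>X. (1 - p) * F X + p * F (insert i X)"] by blast
  obtain b where b: "\<forall>X\<subseteq>N. F (insert i X) - F X = poly N b X"
    using insert.IH[of "\<lambda>X. F (insert i X) - F X"] by blast
  define c where "c T = (if i \<in> T then b (T - {i}) else a T)" for T
  have ca: "poly N c X = poly N a X" for X
    unfolding poly_def using insert.hyps by (intro sum.cong) (auto simp: c_def)
  have cb: "poly N (\<lambda>T. c (insert i T)) X = poly N b X" for X
  proof -
    have "insert i T - {i} = T" if "T \<in> Pow N" for T using that insert.hyps by auto
    then show ?thesis unfolding poly_def by (simp add: c_def)
  qed
  have "F X = poly (insert i N) c X" if X: "X \<subseteq> insert i N" for X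
  proof (cases "i \<in> X")
    case True
    define Y where "Y = X - {i}"
    have Y: "X = insert i Y" "Y \<subseteq> N" using True X by (auto simp: Y_def)
    have "poly (insert i N) c X = poly N a Y + (1 - p) * poly N b Y"
      using insert.hyps by (simp add: poly_insert ca cb Y poly_insert_right)
    also have "\<dots> = F X"
      using a[rule_format, OF Y(2)] b[rule_format, OF Y(2)]
      by (simp flip: Y(1)) (simp add: algebra_simps Y)
    finally show ?thesis by simp
  next
    case False
    then have Y: "X \<subseteq> N" using X by auto
    show ?thesis
      using insert.hyps False a[rule_format, OF Y] b[rule_format, OF Y, symmetric]
      by (simp add: poly_insert ca cb) (simp add: algebra_simps)
  qed
  then show ?case by blast
qed

lemma EE_poly_mult:
  assumes "finite N"
  shows "EE N (\<lambda>X. poly N a X * poly N b X) = (\<Sum>T\<in>Pow N. s ^ card T * (a T * b T))"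
  using assms
proof (induction N arbitrary: a b rule: finite_induct)
  case (insert i N)
  let ?a = "\<lambda>T. a (insert i T)" and ?b = "\<lambda>T. b (insert i T)"
  have "EE (insert i N) (\<lambda>X. poly (insert i N) a X * poly (insert i N) b X) =
      EE N (\<lambda>X. poly N a X * poly N b X + s * (poly N ?a X * poly N ?b X))"
    unfolding EE_insert[OF insert.hyps]
  proof (intro EE_cong)
    fix X assume "X \<subseteq> N"
    then have "i \<notin> X" using insert.hyps by auto
    then show "(1 - p) * (poly (insert i N) a X * poly (insert i N) b X) +
        p * (poly (insert i N) a (insert i X) * poly (insert i N) b (insert i X)) =
      poly N a X * poly N b X + s * (poly N ?a X * poly N ?b X)"
      using insert.hyps
      by (simp add: poly_insert poly_insert_right s_def) (simp add: algebra_simps)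
  qed
  also have "\<dots> = (\<Sum>T\<in>Pow N. s ^ card T * (a T * b T)) + s * (\<Sum>T\<in>Pow N. s ^ card T * (?a T * ?b T))"
    by (simp add: EE_add EE_cmult insert.IH)
  also have "\<dots> = (\<Sum>T\<in>Pow (insert i N). s ^ card T * (a T * b T))"
  proof -
    have "card (insert i T) = Suc (card T)" if "T \<in> Pow N" for T
      using that insert.hyps finite_subset by (subst card_insert_disjoint) auto
    then show ?thesis
      unfolding sum_Pow_insert[OF insert.hyps]
      by (simp add: sum.distrib sum_distrib_left mult_ac)
  qed
  finally show ?case .
qed simp

text \<open>One coordinate of the hypercontractive estimate, for the functions A + (x - p) B and C +
  (x - p) D. The fourth central moment of x is only of order s, not of order s squared, so the last
  term has a factor s. The other cross terms are split by the arithmetic-geometric mean inequality,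
  where the third central moment s * m has \<open>\<bar>m\<bar> \<le> 1\<close>.\<close>

lemma four_point_ineq:
  fixes A B C D :: real
  shows "(1 - p) * ((A - p * B)\<^sup>2 * (C - p * D)\<^sup>2) +
      p * ((A + (1 - p) * B)\<^sup>2 * (C + (1 - p) * D)\<^sup>2)
    \<le> A\<^sup>2 * C\<^sup>2 + 4 * s * (A\<^sup>2 * D\<^sup>2 + B\<^sup>2 * C\<^sup>2) + 3 * s * (B\<^sup>2 * D\<^sup>2)"
proof -
  define m where "m = 1 - 2 * p"
  have m: "m\<^sup>2 \<le> 1"
    using p_pos p_le by (auto simp: m_def abs_square_le_1)
  have *: "2 * (m * (x * y)) \<le> x\<^sup>2 + y\<^sup>2" for x y :: real
  proof -
    have "2 * (x * (m * y)) \<le> x\<^sup>2 + (m * y)\<^sup>2"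
      using sum_squares_bound[of x "m * y"] by simp
    also have "(m * y)\<^sup>2 \<le> 1 * y\<^sup>2"
      unfolding power_mult_distrib using m by (intro mult_right_mono) auto
    finally show ?thesis by (simp add: algebra_simps)
  qed
  define r where "r = 4 * (A * D * (B * C)) + 2 * (m * (A * D * (B * D))) + 2 * (m * (B * C * (B * D)))"
  have "(1 - p) * ((A - p * B)\<^sup>2 * (C - p * D)\<^sup>2) +
      p * ((A + (1 - p) * B)\<^sup>2 * (C + (1 - p) * D)\<^sup>2) =
      A\<^sup>2 * C\<^sup>2 + s * (A\<^sup>2 * D\<^sup>2 + B\<^sup>2 * C\<^sup>2 + r + B\<^sup>2 * D\<^sup>2) - 3 * (s * (B * D))\<^sup>2"
    unfolding s_def m_def r_def by algebra
  also have "\<dots> \<le> A\<^sup>2 * C\<^sup>2 + s * (A\<^sup>2 * D\<^sup>2 + B\<^sup>2 * C\<^sup>2 + r + B\<^sup>2 * D\<^sup>2)" by simp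
  also have "\<dots> \<le> A\<^sup>2 * C\<^sup>2 + s * (4 * (A\<^sup>2 * D\<^sup>2 + B\<^sup>2 * C\<^sup>2) + 3 * (B\<^sup>2 * D\<^sup>2))"
    using *[of "A * D" "B * D"] *[of "B * C" "B * D"] sum_squares_bound[of "A * D" "B * C"] s_pos
    by (intro add_left_mono mult_left_mono) (simp_all add: r_def power_mult_distrib)
  finally show ?thesis by (simp add: algebra_simps)
qed

section \<open>Hypercontractivity for global functions\<close>

text \<open>With \<open>c = s\<close> this is the Fourier mass on the supersets of S. The value
  \<open>c = 4 * s\<close> absorbs the constant of \<open>four_point_ineq\<close> and is traded for
  a factor 4 ^ k at degree k.\<close>

definition up :: "real \<Rightarrow> 'a set \<Rightarrow> ('a set \<Rightarrow> real) \<Rightarrow> 'a set \<Rightarrow> real" where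
  "up c N a S = (\<Sum>T\<in>Pow N. if S \<subseteq> T then c ^ card T * (a T)\<^sup>2 else 0)"

lemma up_nonneg: "0 \<le> c \<Longrightarrow> 0 \<le> up c N a S"
  unfolding up_def by (intro sum_nonneg) auto

lemma up_insert:
  assumes "finite N" "i \<notin> N" "S \<subseteq> N"
  shows "up c (insert i N) a S = up c N a S + c * up c N (\<lambda>T. a (insert i T)) S" (is ?A)
    and "up c (insert i N) a (insert i S) = c * up c N (\<lambda>T. a (insert i T)) S" (is ?B)
proof -
  have c: "card (insert i T) = Suc (card T)" if "T \<in> Pow N" for T
    using that assms finite_subset by (intro card_insert_disjoint) auto
  have S: "S \<subseteq> insert i T \<longleftrightarrow> S \<subseteq> T" "insert i S \<subseteq> insert i T \<longleftrightarrow> S \<subseteq> T" for T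
    using assms by auto
  have S': "\<not> insert i S \<subseteq> T" if "T \<in> Pow N" for T using that assms by auto
  show ?A
    unfolding up_def sum_Pow_insert[OF assms(1,2)] sum_distrib_left sum.distrib[symmetric]
    by (intro sum.cong) (auto simp: c S)
  show ?B
    using S' unfolding up_def sum_Pow_insert[OF assms(1,2)]
    by (simp add: c S sum_distrib_left if_distrib mult_ac cong: if_cong del: insert_subset)
qed

text \<open>
  Since the fourth moment of a character is about \<open>1 / p\<close>, no bound in terms of the second moment
  alone is uniform in \<open>p\<close>; here \<open>(1 / p) ^ card S * up c N a S\<close> measures the energy of the function
  conditioned on all coordinates in \<open>S\<close> being 1. Having two functions \<open>a\<close>, \<open>b\<close>
  makes the induction go through, as the mixed terms then need no Cauchy-Schwarz.
\<close>

lemma hypercontractive: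
  assumes "finite N"
  shows "EE N (\<lambda>X. (poly N a X)\<^sup>2 * (poly N b X)\<^sup>2) \<le>
    (\<Sum>S\<in>Pow N. (1 / p) ^ card S * (up (4 * s) N a S * up (4 * s) N b S))"
  using assms
proof (induction N arbitrary: a b rule: finite_induct)
  case empty
  then show ?case by (simp add: up_def)
next
  case (insert i N)
  let ?a = "\<lambda>T. a (insert i T)" and ?b = "\<lambda>T. b (insert i T)"
  let ?E = "\<lambda>a b. EE N (\<lambda>X. (poly N a X)\<^sup>2 * (poly N b X)\<^sup>2)"
  let ?H = "\<lambda>a b. \<Sum>S\<in>Pow N. (1 / p) ^ card S * (up (4 * s) N a S * up (4 * s) N b S)"
  have "EE (insert i N) (\<lambda>X. (poly (insert i N) a X)\<^sup>2 * (poly (insert i N) b X)\<^sup>2) \<le>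
      EE N (\<lambda>X. (poly N a X)\<^sup>2 * (poly N b X)\<^sup>2 +
        4 * s * ((poly N a X)\<^sup>2 * (poly N ?b X)\<^sup>2 + (poly N ?a X)\<^sup>2 * (poly N b X)\<^sup>2) +
        3 * s * ((poly N ?a X)\<^sup>2 * (poly N ?b X)\<^sup>2))"
    unfolding EE_insert[OF insert.hyps]
  proof (intro EE_mono)
    fix X assume "X \<subseteq> N"
    then have "i \<notin> X" using insert.hyps by auto
    then show "(1 - p) * ((poly (insert i N) a X)\<^sup>2 * (poly (insert i N) b X)\<^sup>2) +
        p * ((poly (insert i N) a (insert i X))\<^sup>2 * (poly (insert i N) b (insert i X))\<^sup>2) \<le>
        (poly N a X)\<^sup>2 * (poly N b X)\<^sup>2 +
        4 * s * ((poly N a X)\<^sup>2 * (poly N ?b X)\<^sup>2 + (poly N ?a X)\<^sup>2 * (poly N b X)\<^sup>2) +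
        3 * s * ((poly N ?a X)\<^sup>2 * (poly N ?b X)\<^sup>2)"
      using insert.hyps four_point_ineq[of "poly N a X" "poly N ?a X" "poly N b X" "poly N ?b X"]
      by (simp add: poly_insert poly_insert_right)
  qed
  also have "\<dots> = ?E a b + 4 * s * (?E a ?b + ?E ?a b) + 3 * s * ?E ?a ?b"
    by (simp add: EE_add EE_cmult)
  also have "\<dots> \<le> ?H a b + 4 * s * (?H a ?b + ?H ?a b) + 3 * s * ?H ?a ?b"
    using s_pos by (intro add_mono mult_left_mono insert.IH) auto
  also have "\<dots> = (\<Sum>S\<in>Pow N. (1 / p) ^ card S * (up (4 * s) N a S * up (4 * s) N b S +
      4 * s * (up (4 * s) N a S * up (4 * s) N ?b S + up (4 * s) N ?a S * up (4 * s) N b S) + 3 * s * (up (4 * s) N ?a S * up (4 * s) N ?b S)))"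
    by (simp add: sum.distrib sum_distrib_left algebra_simps)
  also have "\<dots> \<le> (\<Sum>S\<in>Pow (insert i N).
      (1 / p) ^ card S * (up (4 * s) (insert i N) a S * up (4 * s) (insert i N) b S))"
    unfolding sum_Pow_insert[OF insert.hyps]
  proof (intro sum_mono)
    fix S assume S: "S \<in> Pow N"
    then have c: "card (insert i S) = Suc (card S)"
      using insert.hyps finite_subset by (intro card_insert_disjoint) auto
    define P where "P = up (4 * s) N ?a S * up (4 * s) N ?b S"
    have P: "0 \<le> P" using s_pos by (simp add: P_def up_nonneg)
    \<comment> \<open>Here the weight 1 / p is used: when i joins S, the two energies give 16 * s
      squared, and dividing by p restores the order s of the fourth moment.\<close>
    have "3 * s \<le> 16 * s\<^sup>2 * (1 / p)"
    proof -
      have "16 * s\<^sup>2 * (1 / p) = s * (16 * (1 - p))"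
        using p_pos by (simp add: s_def power2_eq_square)
      also have "\<dots> \<ge> s * 3" using s_pos p_le by (intro mult_left_mono) auto
      finally show ?thesis by simp
    qed
    then have "3 * s * P \<le> 16 * s\<^sup>2 * (1 / p) * P"
      using P by (intro mult_right_mono)
    moreover have "0 \<le> 16 * s\<^sup>2 * P" using P by simp
    ultimately have "3 * s * P \<le> 16 * s\<^sup>2 * P + 16 * s\<^sup>2 * (1 / p) * P" by linarith
    then have "up (4 * s) N a S * up (4 * s) N b S +
        4 * s * (up (4 * s) N a S * up (4 * s) N ?b S + up (4 * s) N ?a S * up (4 * s) N b S) + 3 * s * (up (4 * s) N ?a S * up (4 * s) N ?b S) \<le>
        up (4 * s) (insert i N) a S * up (4 * s) (insert i N) b S +
        1 / p * (up (4 * s) (insert i N) a (insert i S) * up (4 * s) (insert i N) b (insert i S))"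
      using S insert.hyps by (simp add: up_insert P_def power2_eq_square algebra_simps)
    then have "(1 / p) ^ card S * (up (4 * s) N a S * up (4 * s) N b S +
        4 * s * (up (4 * s) N a S * up (4 * s) N ?b S + up (4 * s) N ?a S * up (4 * s) N b S) + 3 * s * (up (4 * s) N ?a S * up (4 * s) N ?b S)) \<le>
        (1 / p) ^ card S * (up (4 * s) (insert i N) a S * up (4 * s) (insert i N) b S +
        1 / p * (up (4 * s) (insert i N) a (insert i S) * up (4 * s) (insert i N) b (insert i S)))"
      using p_pos by (intro mult_left_mono) auto
    then show "(1 / p) ^ card S * (up (4 * s) N a S * up (4 * s) N b S +
        4 * s * (up (4 * s) N a S * up (4 * s) N ?b S + up (4 * s) N ?a S * up (4 * s) N b S) + 3 * s * (up (4 * s) N ?a S * up (4 * s) N ?b S)) \<le>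
        (1 / p) ^ card S * (up (4 * s) (insert i N) a S * up (4 * s) (insert i N) b S) +
        (1 / p) ^ card (insert i S) *
          (up (4 * s) (insert i N) a (insert i S) * up (4 * s) (insert i N) b (insert i S))"
      by (simp add: c algebra_simps)
  qed
  finally show ?case .
qed

section \<open>Energies above a set: degree, double counting, bounded functions\<close>

lemma up_mono: "0 \<le> c \<Longrightarrow> (\<And>T. T \<subseteq> N \<Longrightarrow> (a T)\<^sup>2 \<le> (b T)\<^sup>2) \<Longrightarrow> up c N a S \<le> up c N b S"
  unfolding up_def by (intro sum_mono) (auto intro!: mult_left_mono)

lemma up_scale:
  assumes "\<And>T. T \<subseteq> N \<Longrightarrow> a T \<noteq> 0 \<Longrightarrow> card T \<le> k"
  shows "up (4 * s) N a S \<le> 4 ^ k * up s N a S"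
  unfolding up_def sum_distrib_left
proof (intro sum_mono)
  fix T assume T: "T \<in> Pow N"
  show "(if S \<subseteq> T then (4 * s) ^ card T * (a T)\<^sup>2 else 0) \<le>
      4 ^ k * (if S \<subseteq> T then s ^ card T * (a T)\<^sup>2 else 0)"
  proof (cases "S \<subseteq> T \<and> a T \<noteq> 0")
    case True
    then have "(4::real) ^ card T * (s ^ card T * (a T)\<^sup>2) \<le> 4 ^ k * (s ^ card T * (a T)\<^sup>2)"
      using assms T s_pos by (intro mult_right_mono power_increasing) auto
    then show ?thesis using True by (simp add: power_mult_distrib mult_ac)
  qed auto
qed

text \<open>Double counting: each T is counted once for each of its at most 2 ^ k subsets.\<close>

lemma sum_up:
  assumes "finite N" "0 \<le> c" "\<And>T. T \<subseteq> N \<Longrightarrow> a T \<noteq> 0 \<Longrightarrow> card T \<le> k"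
  shows "(\<Sum>S\<in>Pow N. up c N a S) \<le> 2 ^ k * (\<Sum>T\<in>Pow N. c ^ card T * (a T)\<^sup>2)"
proof -
  have "(\<Sum>S\<in>Pow N. up c N a S) =
      (\<Sum>T\<in>Pow N. \<Sum>S\<in>Pow N. if S \<subseteq> T then c ^ card T * (a T)\<^sup>2 else 0)"
    unfolding up_def by (rule sum.swap)
  also have "\<dots> \<le> (\<Sum>T\<in>Pow N. 2 ^ k * (c ^ card T * (a T)\<^sup>2))"
  proof (intro sum_mono)
    fix T assume T: "T \<in> Pow N"
    then have "finite T" using assms finite_subset by auto
    have "(\<Sum>S\<in>Pow N. if S \<subseteq> T then c ^ card T * (a T)\<^sup>2 else 0) =
        (\<Sum>S\<in>Pow T. c ^ card T * (a T)\<^sup>2)"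
      using assms T by (intro sum.mono_neutral_cong_right) auto
    also have "\<dots> = 2 ^ card T * (c ^ card T * (a T)\<^sup>2)"
      using \<open>finite T\<close> by (simp add: card_Pow)
    also have "\<dots> \<le> 2 ^ k * (c ^ card T * (a T)\<^sup>2)"
      using assms(2) assms(3)[of T] T
      by (cases "a T = 0") (auto intro!: mult_right_mono power_increasing)
    finally show "(\<Sum>S\<in>Pow N. if S \<subseteq> T then c ^ card T * (a T)\<^sup>2 else 0) \<le>
      2 ^ k * (c ^ card T * (a T)\<^sup>2)" .
  qed
  finally show ?thesis by (simp add: sum_distrib_left)
qed

lemma up_empty: "up c N a {} = (\<Sum>T\<in>Pow N. c ^ card T * (a T)\<^sup>2)"
  by (simp add: up_def)

lemma parseval: "finite N \<Longrightarrow> EE N (\<lambda>X. (poly N a X)\<^sup>2) = (\<Sum>T\<in>Pow N. s ^ card T * (a T)\<^sup>2)"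
  using EE_poly_mult[of N a a] by (simp add: power2_eq_square)

lemma deriv_poly:
  assumes "finite N" "j \<in> N"
  shows "deriv j (poly N a) X = poly N (\<lambda>T. if j \<in> T then 0 else a (insert j T)) X"
proof -
  define M where "M = N - {j}"
  have M: "finite M" "j \<notin> M" "N = insert j M" using assms by (auto simp: M_def)
  have *: "poly M b X = poly M b (X - {j})" for b
    using poly_insert_right[OF M(2), of b X] poly_insert_right[OF M(2), of b "X - {j}"] by simp
  have "poly M (\<lambda>T. if j \<in> T then 0 else a (insert j T)) X = poly M (\<lambda>T. a (insert j T)) X"
    unfolding poly_def using M by (intro sum.cong) auto
  moreover have "poly M (\<lambda>T. 0) X = 0" by (simp add: poly_def)
  ultimately show ?thesis
    unfolding M(3) deriv_def using M
    by (simp add: poly_insert poly_insert_right *[symmetric]) (simp add: algebra_simps)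
qed

text \<open>The elements of S are peeled off by differences. A difference in direction j has as
  coefficients those of the sets through j, it at most doubles the sup norm, and the removed
  coordinate contributes s; together this is 4 * s per element.\<close>

lemma up_bound:
  assumes "finite N" "S \<subseteq> N" "\<And>X. X \<subseteq> N \<Longrightarrow> \<bar>poly N a X\<bar> \<le> C"
  shows "up s N a S \<le> (4 * s) ^ card S * C\<^sup>2"
proof -
  have "finite S" using assms finite_subset by blast
  then show ?thesis using assms(2,3)
  proof (induction S arbitrary: a C rule: finite_induct)
    case empty
    have "(poly N a X)\<^sup>2 \<le> C\<^sup>2" if "X \<subseteq> N" for X
      using empty(2)[OF that] by (metis abs_ge_zero power2_abs power_mono)
    then have "EE N (\<lambda>X. (poly N a X)\<^sup>2) \<le> EE N (\<lambda>X. C\<^sup>2)" by (intro EE_mono)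
    then show ?case using assms(1) by (simp add: parseval up_empty EE_const)
  next
    case (insert j S)
    define M where "M = N - {j}"
    have M: "finite M" "j \<notin> M" "N = insert j M" "S \<subseteq> M"
      using assms insert by (auto simp: M_def)
    define b where "b T = (if j \<in> T then 0 else a (insert j T))" for T
    have "\<bar>poly N b X\<bar> \<le> 2 * C" if "X \<subseteq> N" for X
    proof -
      have "poly N b X = poly N a (insert j X) - poly N a (X - {j})"
        unfolding b_def using deriv_poly[of N j a X] insert.prems assms by (simp add: deriv_def)
      moreover have "insert j X \<subseteq> N" "X - {j} \<subseteq> N" using insert.prems(1) that by auto
      then have "\<bar>poly N a (insert j X)\<bar> \<le> C" "\<bar>poly N a (X - {j})\<bar> \<le> C"
        by (simp_all only: insert.prems(2))
      ultimately show ?thesis by linarith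
    qed
    then have "up s N b S \<le> (4 * s) ^ card S * (2 * C)\<^sup>2"
      using insert.prems by (intro insert.IH) auto
    moreover have "up s N b S = up s M (\<lambda>T. a (insert j T)) S"
    proof -
      have "up s M b S = up s M (\<lambda>T. a (insert j T)) S"
        unfolding up_def b_def using M by (intro sum.cong) auto
      moreover have "up s M (\<lambda>T. b (insert j T)) S = 0"
        by (simp add: up_def b_def cong: if_cong)
      ultimately show ?thesis using M(1,2,4) unfolding M(3) by (simp add: up_insert)
    qed
    moreover have "up s N a (insert j S) = s * up s M (\<lambda>T. a (insert j T)) S"
      using M(1,2,4) unfolding M(3) by (rule up_insert(2))
    ultimately have "up s N a (insert j S) \<le> s * ((4 * s) ^ card S * (2 * C)\<^sup>2)"
      using s_pos by (simp add: mult_left_mono)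
    then show ?case using insert.hyps by (simp add: power2_eq_square mult_ac)
  qed
qed

end

section \<open>The Fourier mass sits on unions of active sets\<close>

text \<open>Here d lists the Fourier coefficients of F, k is the degree cut-off, \<delta> the
  threshold for activity and \<eta> the one for heaviness. The level 1 / t separates small from
  large values in \<open>unc_mass\<close>, and the equation for \<delta> makes the fourth-moment
  term there exactly half of the mass to be bounded.\<close>

locale boolean_fn = biased p for p :: real +
  fixes N :: "'a set" and F d :: "'a set \<Rightarrow> real" and k :: nat and t \<delta> \<eta> :: real
  assumes fin: "finite N"
    and F01: "X \<subseteq> N \<Longrightarrow> F X = 0 \<or> F X = 1"
    and F_mono: "X \<subseteq> Y \<Longrightarrow> Y \<subseteq> N \<Longrightarrow> F X \<le> F Y"
    and F_poly: "X \<subseteq> N \<Longrightarrow> F X = poly N d X"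
    and k_pos: "1 \<le> k"
    and \<eta>_pos: "0 < \<eta>"
    and t_pos: "0 < t" and \<delta>: "4 * 32 ^ k * t ^ 3 * \<delta> = 1"
begin

definition dk :: "'a set \<Rightarrow> real" where
  "dk T = (if card T \<le> k then d T else 0)"

text \<open>
  A set is active if conditioning on its coordinates being 1 makes the energy above it large.
  The empty set counts as active so that unions of at most \<open>m\<close> active sets increase with \<open>m\<close>.
\<close>

definition active :: "'a set \<Rightarrow> bool" where
  "active S \<longleftrightarrow> S \<subseteq> N \<and> card S \<le> k \<and> (S = {} \<or> \<delta> \<le> (1 / p) ^ card S * up s N dk S)"

text \<open>These are the unions of active sets of size at most k. In the pointwise form, failure
  singles out a coordinate j with no active set through it inside T, to which the mass of T is
  charged by \<open>unc j\<close>.\<close>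

definition covered :: "'a set set" where
  "covered = {T. T \<subseteq> N \<and> card T \<le> k \<and> (\<forall>i\<in>T. \<exists>S. active S \<and> i \<in> S \<and> S \<subseteq> T)}"

definition unc :: "'a \<Rightarrow> 'a set \<Rightarrow> real" where
  "unc j T = (if j \<in> T \<and> card T \<le> k \<and> (\<forall>S. active S \<longrightarrow> j \<in> S \<longrightarrow> \<not> S \<subseteq> T) then d T else 0)"

text \<open>The factor \<open>2 * s\<close> is the probability that re-randomising a coordinate
  changes it, so this is the influence of the theorem; see \<open>influence_eq\<close>.\<close>

definition infl :: "'a \<Rightarrow> real" where
  "infl j = 2 * s * EE N (deriv j F)"

lemma \<delta>_pos: "0 < \<delta>"
proof (rule ccontr)
  assume "\<not> 0 < \<delta>"
  then have "4 * 32 ^ k * t ^ 3 * \<delta> \<le> 0" using t_pos by (intro mult_nonneg_nonpos) auto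
  then show False using \<delta> by simp
qed

lemma finN: "X \<subseteq> N \<Longrightarrow> finite X"
  using fin finite_subset by blast

lemma deriv01:
  assumes "j \<in> N" "X \<subseteq> N"
  shows "deriv j F X = 0 \<or> deriv j F X = 1"
proof -
  have *: "insert j X \<subseteq> N" "X - {j} \<subseteq> N" using assms by auto
  have "F (X - {j}) \<le> F (insert j X)" using *(1) by (intro F_mono) auto
  then show ?thesis using F01[OF *(1)] F01[OF *(2)] by (auto simp: deriv_def)
qed

text \<open>Both sides are F minus its average over coordinate j. For Boolean increasing F the right
  side only takes the values 0, - p and 1 - p.\<close>

lemma weighted_deriv:
  assumes "j \<in> N" "X \<subseteq> N"
  shows "poly N (\<lambda>T. if j \<in> T then d T else 0) X = (of_bool (j \<in> X) - p) * deriv j F X"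
proof -
  define M where "M = N - {j}"
  have M: "finite M" "j \<notin> M" "N = insert j M" using assms fin by (auto simp: M_def)
  have "deriv j F X = deriv j (poly N d) X"
    unfolding deriv_def using assms by (subst (1 2) F_poly) auto
  also have "\<dots> = poly N (\<lambda>T. if j \<in> T then 0 else d (insert j T)) X"
    using assms fin by (intro deriv_poly)
  also have "\<dots> = poly M (\<lambda>T. d (insert j T)) X"
  proof -
    have "poly M (\<lambda>T. if j \<in> T then 0 else d (insert j T)) X = poly M (\<lambda>T. d (insert j T)) X"
      unfolding poly_def using M by (intro sum.cong) auto
    moreover have "poly M (\<lambda>T. 0) X = 0" by (simp add: poly_def)
    ultimately show ?thesis unfolding M(3) using M by (simp add: poly_insert)
  qed
  finally have "deriv j F X = poly M (\<lambda>T. d (insert j T)) X" .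
  moreover have "poly M (\<lambda>T. if j \<in> T then d T else 0) X = 0"
    unfolding poly_def using M by (intro sum.neutral) auto
  ultimately show ?thesis unfolding M(3) using M by (simp add: poly_insert)
qed

lemma EE_weight_deriv:
  assumes "j \<in> N"
  shows "EE N (\<lambda>X. g (of_bool (j \<in> X)) * deriv j F X) = ((1 - p) * g 0 + p * g 1) * EE N (deriv j F)"
proof -
  have "EE N (\<lambda>X. g (of_bool (j \<in> X)) * deriv j F X) =
      EE N (\<lambda>X. ((1 - p) * g 0 + p * g 1) * deriv j F X)"
    using fin assms
    by (subst EE_remove[where j = j]) (auto simp: deriv_def algebra_simps)
  then show ?thesis by (simp add: EE_cmult)
qed

text \<open>Since the derivative is 0 or 1 it equals its square, and (x - p) squared has mean s.
  Summed over j, this turns total influence into twice the Fourier mass weighted by the size of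
  T.\<close>

lemma infl_eq_sum:
  assumes "j \<in> N"
  shows "infl j = 2 * (\<Sum>T\<in>Pow N. if j \<in> T then s ^ card T * (d T)\<^sup>2 else 0)"
proof -
  let ?g = "\<lambda>x :: real. (x - p)\<^sup>2"
  have "(\<Sum>T\<in>Pow N. if j \<in> T then s ^ card T * (d T)\<^sup>2 else 0) =
      EE N (\<lambda>X. (poly N (\<lambda>T. if j \<in> T then d T else 0) X)\<^sup>2)"
    unfolding parseval[OF fin] by (intro sum.cong) auto
  also have "\<dots> = EE N (\<lambda>X. ?g (of_bool (j \<in> X)) * deriv j F X)"
  proof (intro EE_cong)
    fix X assume "X \<subseteq> N"
    then show "(poly N (\<lambda>T. if j \<in> T then d T else 0) X)\<^sup>2 = ?g (of_bool (j \<in> X)) * deriv j F X"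
      using deriv01[OF assms \<open>X \<subseteq> N\<close>]
      by (elim disjE) (simp_all add: weighted_deriv[OF assms])
  qed
  also have "\<dots> = ((1 - p) * ?g 0 + p * ?g 1) * EE N (deriv j F)"
    by (rule EE_weight_deriv[OF assms])
  also have "(1 - p) * ?g 0 + p * ?g 1 = s"
    by (simp add: s_def power2_eq_square algebra_simps)
  finally show ?thesis by (simp add: infl_def)
qed

lemma infl_nonneg: "j \<in> N \<Longrightarrow> 0 \<le> infl j"
  using s_pos by (auto simp: infl_eq_sum intro!: sum_nonneg)

text \<open>Because \<open>unc j\<close> lives on sets through j, the energies above S and
  \<open>insert j S\<close> agree. If they are nonzero, \<open>insert j S\<close> is inactive, so
  one of the two energy factors in \<open>hypercontractive\<close>, rescaled by its power of 1 / p,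
  is at most \<delta>; the other is summed over S. The base 32 is 4 * 4 from passing to
  \<open>up s\<close> in both factors, times 2 from \<open>sum_up\<close>.\<close>

lemma unc_fourth_moment:
  assumes "j \<in> N"
  shows "EE N (\<lambda>X. (poly N (unc j) X) ^ 4) \<le> 2 * 32 ^ k * \<delta> * (\<Sum>T\<in>Pow N. s ^ card T * (unc j T)\<^sup>2)"
proof -
  define M where "M = N - {j}"
  have M: "finite M" "j \<notin> M" "N = insert j M" using assms fin by (auto simp: M_def)
  have supp: "unc j T \<noteq> 0 \<Longrightarrow> card T \<le> k" for T by (auto simp: unc_def split: if_splits)
  let ?u = "up s N (unc j)"
  have u0: "0 \<le> ?u S" for S using s_pos by (simp add: up_nonneg)
  have "EE N (\<lambda>X. (poly N (unc j) X) ^ 4) \<le>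
      (\<Sum>S\<in>Pow N. (1 / p) ^ card S * (up (4 * s) N (unc j) S * up (4 * s) N (unc j) S))"
    using hypercontractive[OF fin, of "unc j" "unc j"] by (simp flip: power_add)
  also have "\<dots> \<le> (\<Sum>S\<in>Pow N. (1 / p) ^ card S * ((4 ^ k * ?u S) * (4 ^ k * ?u S)))"
    using supp p_pos s_pos u0
    by (intro sum_mono mult_left_mono mult_mono up_scale) (auto intro: up_nonneg)
  also have "\<dots> = 16 ^ k * (\<Sum>S\<in>Pow N. (1 / p) ^ card S * (?u S)\<^sup>2)"
  proof -
    have 16: "(16::real) ^ k = 4 ^ k * 4 ^ k" unfolding power_mult_distrib[symmetric] by simp
    show ?thesis unfolding 16 sum_distrib_left
      by (intro sum.cong) (simp_all add: power2_eq_square mult_ac)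
  qed
  also have "(\<Sum>S\<in>Pow N. (1 / p) ^ card S * (?u S)\<^sup>2) \<le> (\<Sum>S\<in>Pow N. 2 * \<delta> * ?u S)"
    unfolding M(3) sum_Pow_insert[OF M(1,2)] unfolding M(3)[symmetric]
  proof (intro sum_mono)
    fix S assume S: "S \<in> Pow M"
    have c: "card (insert j S) = Suc (card S)" using S M finite_subset by (intro card_insert_disjoint) auto
    have eq: "?u S = ?u (insert j S)"
      unfolding up_def by (intro sum.cong) (auto simp: unc_def)
    have le: "(1 / p) ^ card (insert j S) * (?u (insert j S))\<^sup>2 \<le> \<delta> * ?u (insert j S)"
    proof (cases "?u (insert j S) = 0")
      case False
      \<comment> \<open>Such a T bounds the size of \<open>insert j S\<close> by k and, containing
        no active set through j, shows that it is inactive.\<close>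
      have "\<exists>T\<in>Pow N. insert j S \<subseteq> T \<and> unc j T \<noteq> 0"
      proof (rule ccontr)
        assume "\<not> ?thesis"
        then have "?u (insert j S) = 0" unfolding up_def by (intro sum.neutral) auto
        then show False using False by simp
      qed
      then obtain T where T: "T \<subseteq> N" "insert j S \<subseteq> T" "unc j T \<noteq> 0" by auto
      then have "card (insert j S) \<le> k" "\<not> active (insert j S)"
        using card_mono[OF finN[OF T(1)] T(2)] supp[OF T(3)] by (auto simp: unc_def split: if_splits)
      then have "(1 / p) ^ card (insert j S) * up s N dk (insert j S) < \<delta>"
        using T(1,2) unfolding active_def by (simp add: not_le) (meson insertI1 subset_iff)
      moreover have "?u (insert j S) \<le> up s N dk (insert j S)"
        using s_pos by (intro up_mono) (auto simp: unc_def dk_def)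
      then have "(1 / p) ^ card (insert j S) * ?u (insert j S) \<le>
          (1 / p) ^ card (insert j S) * up s N dk (insert j S)"
        using p_pos by (intro mult_left_mono) auto
      ultimately have "(1 / p) ^ card (insert j S) * ?u (insert j S) \<le> \<delta>" by linarith
      then have "(1 / p) ^ card (insert j S) * ?u (insert j S) * ?u (insert j S) \<le> \<delta> * ?u (insert j S)"
        by (intro mult_right_mono u0)
      then show ?thesis by (simp add: power2_eq_square mult.assoc)
    qed simp
    have "(1 / p) ^ card S * (?u S)\<^sup>2 \<le> (1 / p) ^ card (insert j S) * (?u (insert j S))\<^sup>2"
      unfolding eq c using p_pos p_le by (intro mult_right_mono power_increasing) auto
    then show "(1 / p) ^ card S * (?u S)\<^sup>2 + (1 / p) ^ card (insert j S) * (?u (insert j S))\<^sup>2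
      \<le> 2 * \<delta> * ?u S + 2 * \<delta> * ?u (insert j S)"
      using le mult_nonneg_nonneg[OF less_imp_le[OF \<delta>_pos] u0, of "insert j S"]
      unfolding eq mult.assoc by linarith
  qed
  also have "\<dots> = 2 * \<delta> * (\<Sum>S\<in>Pow N. ?u S)" by (simp add: sum_distrib_left)
  also have "\<dots> \<le> 2 * \<delta> * (2 ^ k * (\<Sum>T\<in>Pow N. s ^ card T * (unc j T)\<^sup>2))"
    using fin s_pos \<delta>_pos supp by (intro mult_left_mono sum_up) auto
  finally have *: "EE N (\<lambda>X. (poly N (unc j) X) ^ 4) \<le>
    16 ^ k * (2 * \<delta> * (2 ^ k * (\<Sum>T\<in>Pow N. s ^ card T * (unc j T)\<^sup>2)))" by simp
  have 32: "(32::real) ^ k = 16 ^ k * 2 ^ k" unfolding power_mult_distrib[symmetric] by simp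
  show ?thesis using * unfolding 32 by (simp only: mult_ac)
qed

text \<open>The mass m equals the pairing of \<open>unc j\<close> with all sets through j, a
  function with values in [-1, 1] and first absolute moment \<open>infl j\<close>. The fourth moment
  of \<open>unc j\<close> is bounded by a multiple of m itself, so the pairing is at most m / 2 +
  infl j / t.\<close>

lemma unc_mass:
  assumes "j \<in> N"
  shows "(\<Sum>T\<in>Pow N. s ^ card T * (unc j T)\<^sup>2) \<le> 2 * infl j / t"
proof -
  define m where "m = (\<Sum>T\<in>Pow N. s ^ card T * (unc j T)\<^sup>2)"
  let ?c = "\<lambda>T. if j \<in> T then d T else 0"
  let ?g = "\<lambda>x. \<bar>x - p\<bar>"
  have "m = EE N (\<lambda>X. poly N (unc j) X * poly N ?c X)"
    unfolding m_def EE_poly_mult[OF fin]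
    by (intro sum.cong) (auto simp: unc_def power2_eq_square)
  also have "\<dots> \<le> EE N (\<lambda>X. t ^ 3 * poly N (unc j) X ^ 4 + 1 / t * (?g (of_bool (j \<in> X)) * deriv j F X))"
  proof (intro EE_mono)
    fix X assume X: "X \<subseteq> N"
    define u where "u = ?g (of_bool (j \<in> X)) * deriv j F X"
    define g where "g = poly N (unc j) X"
    have u: "\<bar>poly N ?c X\<bar> = u" "0 \<le> u" "u \<le> 1"
      using deriv01[OF assms X] p_pos p_le
      by (auto simp: weighted_deriv[OF assms X] abs_mult u_def)
    \<comment> \<open>stands in for Hoelder with exponents 4 and 4/3; it uses that \<open>u\<close> is at most 1\<close>
    have "g * poly N ?c X \<le> \<bar>g\<bar> * u"
      unfolding u(1)[symmetric] by (metis abs_ge_self abs_mult)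
    also have "\<dots> \<le> t ^ 3 * g ^ 4 + 1 / t * u"
    proof (cases "\<bar>g\<bar> * t \<le> 1")
      case True
      then have "\<bar>g\<bar> \<le> 1 / t" using t_pos by (simp add: field_simps)
      then have "\<bar>g\<bar> * u \<le> 1 / t * u" using u by (intro mult_right_mono)
      moreover have "0 \<le> t ^ 3 * g ^ 4" using t_pos by simp
      ultimately show ?thesis by linarith
    next
      case False
      then have "1 \<le> (\<bar>g\<bar> * t) ^ 3" by (intro one_le_power) auto
      then have "\<bar>g\<bar> * 1 \<le> \<bar>g\<bar> * (\<bar>g\<bar> * t) ^ 3" by (intro mult_left_mono) auto
      also have "\<dots> = t ^ 3 * \<bar>g\<bar> ^ 4" by (simp add: power_mult_distrib power_eq_if)
      also have "\<dots> = t ^ 3 * g ^ 4" by simp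
      finally have "\<bar>g\<bar> \<le> t ^ 3 * g ^ 4" by simp
      moreover have "\<bar>g\<bar> * u \<le> \<bar>g\<bar> * 1" using u by (intro mult_left_mono) auto
      moreover have "0 \<le> 1 / t * u" using t_pos u by simp
      ultimately show ?thesis by linarith
    qed
    finally show "poly N (unc j) X * poly N ?c X \<le>
      t ^ 3 * poly N (unc j) X ^ 4 + 1 / t * (?g (of_bool (j \<in> X)) * deriv j F X)"
      by (simp add: g_def u_def)
  qed
  also have "\<dots> = t ^ 3 * EE N (\<lambda>X. poly N (unc j) X ^ 4) +
      1 / t * EE N (\<lambda>X. ?g (of_bool (j \<in> X)) * deriv j F X)"
    by (rule EE_linear)
  also have "EE N (\<lambda>X. ?g (of_bool (j \<in> X)) * deriv j F X) =
      ((1 - p) * ?g 0 + p * ?g 1) * EE N (deriv j F)"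
    by (rule EE_weight_deriv[OF assms])
  also have "\<dots> = infl j"
    using p_pos p_le by (simp add: infl_def s_def)
  also have "t ^ 3 * EE N (\<lambda>X. poly N (unc j) X ^ 4) \<le> t ^ 3 * (2 * 32 ^ k * \<delta> * m)"
    using unc_fourth_moment[OF assms] t_pos by (intro mult_left_mono) (auto simp: m_def)
  also have "\<dots> = (4 * 32 ^ k * t ^ 3 * \<delta>) * (m / 2)" by simp
  also have "\<dots> = m / 2" using \<delta> by simp
  finally show ?thesis by (simp add: m_def)
qed

text \<open>An uncovered T larger than k is charged to total influence, which counts it more than 2
  * k times; a smaller one is charged to \<open>unc j\<close> for a coordinate j of T in no active
  subset.\<close>

lemma uncovered_mass:
  "(\<Sum>T\<in>Pow N - covered. s ^ card T * (d T)\<^sup>2) \<le>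
    (1 / (2 * k) + 2 / t) * (\<Sum>j\<in>N. infl j)"
proof -
  let ?w = "\<lambda>T. s ^ card T * (d T)\<^sup>2"
  have w0: "0 \<le> ?w T" for T using s_pos by simp
  have "(\<Sum>T\<in>Pow N - covered. ?w T) \<le>
      (\<Sum>T\<in>Pow N. 1 / (2 * k) * (\<Sum>j\<in>N. 2 * (if j \<in> T then ?w T else 0)) +
        (\<Sum>j\<in>N. s ^ card T * (unc j T)\<^sup>2))"
  proof (rule sum_le_included[where i = id], goal_cases)
    case 4
    show ?case
    proof (intro ballI, goal_cases)
      case (1 T)
      then have T: "T \<subseteq> N" "T \<notin> covered" by auto
      have A: "0 \<le> (\<Sum>j\<in>N. s ^ card T * (unc j T)\<^sup>2)" using s_pos by (intro sum_nonneg) auto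
      have B: "0 \<le> 1 / (2 * k) * (\<Sum>j\<in>N. 2 * (if j \<in> T then ?w T else 0))"
        using w0 by (intro mult_nonneg_nonneg sum_nonneg) auto
      have "?w T \<le> 1 / (2 * k) * (\<Sum>j\<in>N. 2 * (if j \<in> T then ?w T else 0)) +
          (\<Sum>j\<in>N. s ^ card T * (unc j T)\<^sup>2)"
      proof (cases "card T \<le> k")
        case True
        then obtain j where j: "j \<in> T" "\<forall>S. active S \<longrightarrow> j \<in> S \<longrightarrow> \<not> S \<subseteq> T"
          using T by (auto simp: covered_def)
        then have "?w T = s ^ card T * (unc j T)\<^sup>2" using True by (simp add: unc_def)
        also have "\<dots> \<le> (\<Sum>j\<in>N. s ^ card T * (unc j T)\<^sup>2)"
          using j T fin s_pos by (intro member_le_sum) auto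
        finally show ?thesis using B by linarith
      next
        case False
        have "(\<Sum>j\<in>N. 2 * (if j \<in> T then ?w T else 0)) = (\<Sum>j\<in>T. 2 * ?w T)"
          using T fin by (intro sum.mono_neutral_cong_right) auto
        then have "1 / (2 * k) * (\<Sum>j\<in>N. 2 * (if j \<in> T then ?w T else 0)) = card T / k * ?w T"
          using k_pos by simp
        moreover have "1 * ?w T \<le> card T / k * ?w T"
          using False k_pos w0 by (intro mult_right_mono) (auto simp: field_simps)
        ultimately show ?thesis using A by linarith
      qed
      then show ?case using T by (intro bexI[of _ T]) auto
    qed
  next
    case 3
    have "0 \<le> (\<Sum>j\<in>N. 2 * (if j \<in> T then ?w T else 0))" for T
      using w0 by (intro sum_nonneg) simp
    moreover have "0 \<le> (\<Sum>j\<in>N. s ^ card T * (unc j T)\<^sup>2)" for T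
      using s_pos by (intro sum_nonneg) simp
    ultimately show ?case by simp
  qed (use fin in auto)
  also have "\<dots> = 1 / (2 * k) * (\<Sum>j\<in>N. 2 * (\<Sum>T\<in>Pow N. if j \<in> T then ?w T else 0)) +
      (\<Sum>j\<in>N. \<Sum>T\<in>Pow N. s ^ card T * (unc j T)\<^sup>2)"
  proof -
    have 1: "(\<Sum>T\<in>Pow N. \<Sum>j\<in>N. s ^ card T * (unc j T)\<^sup>2) = (\<Sum>j\<in>N. \<Sum>T\<in>Pow N. s ^ card T * (unc j T)\<^sup>2)"
      by (rule sum.swap)
    have 2: "(\<Sum>T\<in>Pow N. \<Sum>j\<in>N. 2 * (if j \<in> T then ?w T else 0)) =
        (\<Sum>j\<in>N. 2 * (\<Sum>T\<in>Pow N. if j \<in> T then ?w T else 0))"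
      unfolding sum_distrib_left by (rule sum.swap)
    show ?thesis unfolding sum.distrib 1 2[symmetric] by (simp only: sum_distrib_left)
  qed
  also have "\<dots> \<le> 1 / (2 * k) * (\<Sum>j\<in>N. infl j) + (\<Sum>j\<in>N. 2 * infl j / t)"
    by (intro add_mono sum_mono unc_mass order.refl) (simp add: infl_eq_sum)
  also have "(\<Sum>j\<in>N. 2 * infl j / t) = 2 / t * (\<Sum>j\<in>N. infl j)"
    by (simp add: sum_distrib_left)
  finally show ?thesis by (simp add: algebra_simps)
qed

end

context biased
begin

section \<open>Unions of few members of a family with light links\<close>

lemma sum_up_above:
  assumes "finite N" "0 \<le> c" "\<And>T. T \<subseteq> N \<Longrightarrow> a T \<noteq> 0 \<Longrightarrow> card T \<le> k"
  shows "(\<Sum>S | S \<subseteq> N \<and> U \<subseteq> S. up c N a S) \<le> 2 ^ k * up c N a U"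
proof -
  define b where "b T = (if U \<subseteq> T then a T else 0)" for T
  have "(\<Sum>S | S \<subseteq> N \<and> U \<subseteq> S. up c N a S) = (\<Sum>S | S \<subseteq> N \<and> U \<subseteq> S. up c N b S)"
    unfolding up_def b_def by (intro sum.cong refl) auto
  also have "\<dots> \<le> (\<Sum>S\<in>Pow N. up c N b S)"
    using assms by (intro sum_mono2) (auto intro: up_nonneg)
  also have "\<dots> \<le> 2 ^ k * (\<Sum>T\<in>Pow N. c ^ card T * (b T)\<^sup>2)"
    using assms by (intro sum_up) (auto simp: b_def split: if_splits)
  also have "(\<Sum>T\<in>Pow N. c ^ card T * (b T)\<^sup>2) = up c N a U"
    unfolding up_def b_def by (intro sum.cong) auto
  finally show ?thesis .
qed

text \<open>The size cap holds at every step, so that each new member meets the current union in one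
  of at most 2 ^ k sets.\<close>

fun unions :: "nat \<Rightarrow> 'a set set \<Rightarrow> nat \<Rightarrow> 'a set set" where
  "unions k \<A> 0 = {{}}"
| "unions k \<A> (Suc m) = {T \<union> S | T S. T \<in> unions k \<A> m \<and> S \<in> \<A> \<and> card (T \<union> S) \<le> k}"

lemma unions_mem:
  assumes "\<And>S. S \<in> \<A> \<Longrightarrow> finite S" "T \<in> unions k \<A> m"
  shows "finite T \<and> card T \<le> k"
  using assms(2) by (induction m arbitrary: T) (auto simp: assms(1))

lemma unions_Suc:
  assumes "\<And>S. S \<in> \<A> \<Longrightarrow> finite S" "{} \<in> \<A>" "m \<le> m'"
  shows "unions k \<A> m \<subseteq> unions k \<A> m'"
proof (rule lift_Suc_mono_le[OF _ assms(3)])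
  fix m
  show "unions k \<A> m \<subseteq> unions k \<A> (Suc m)"
  proof
    fix T assume T: "T \<in> unions k \<A> m"
    then have "card T \<le> k" using unions_mem[of \<A> T k m] assms(1) by blast
    then show "T \<in> unions k \<A> (Suc m)"
      using T assms(2) by simp (metis sup_bot_right)
  qed
qed

lemma finite_unions: "finite \<A> \<Longrightarrow> finite (unions k \<A> m)"
proof (induction m)
  case (Suc m)
  have "unions k \<A> (Suc m) \<subseteq> (\<lambda>(T, S). T \<union> S) ` (unions k \<A> m \<times> \<A>)" by auto
  then show ?case using Suc finite_subset by blast
qed simp

text \<open>Joining S to T costs the factor \<open>p ^ card (S - T)\<close>. Grouping S by its
  intersection U with T, the members above U contribute at most B, and there are at most 2 ^ k
  choices of U. The inner sum runs over all U inside both sets, which only increases it.\<close>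

lemma sum_unions:
  assumes fin: "finite \<A>" "\<And>S. S \<in> \<A> \<Longrightarrow> finite S"
    and B: "\<And>U. finite U \<Longrightarrow> (\<Sum>S | S \<in> \<A> \<and> U \<subseteq> S. p ^ card (S - U)) \<le> B"
  shows "(\<Sum>T\<in>unions k \<A> m. p ^ card T) \<le> (2 ^ k * B) ^ m"
proof (induction m)
  case (Suc m)
  have B0: "0 \<le> B" by (rule order.trans[OF _ B[of "{}"]]) (use p_pos in \<open>auto intro: sum_nonneg\<close>)
  have "(\<Sum>T\<in>unions k \<A> (Suc m). p ^ card T) \<le>
      (\<Sum>x\<in>unions k \<A> m \<times> \<A>. p ^ card (fst x \<union> snd x))"
  proof (rule sum_le_included[where i = "\<lambda>x. fst x \<union> snd x"])
    show "\<forall>x\<in>unions k \<A> (Suc m). \<exists>y\<in>unions k \<A> m \<times> \<A>.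
        fst y \<union> snd y = x \<and> p ^ card x \<le> p ^ card (fst y \<union> snd y)"
    proof
      fix x assume "x \<in> unions k \<A> (Suc m)"
      then obtain T S where "x = T \<union> S" "T \<in> unions k \<A> m" "S \<in> \<A>" by auto
      then show "\<exists>y\<in>unions k \<A> m \<times> \<A>. fst y \<union> snd y = x \<and> p ^ card x \<le> p ^ card (fst y \<union> snd y)"
        by (intro bexI[of _ "(T, S)"]) auto
    qed
  qed (use fin p_pos in \<open>auto intro: finite_unions simp del: unions.simps\<close>)
  also have "\<dots> = (\<Sum>T\<in>unions k \<A> m. \<Sum>S\<in>\<A>. p ^ card (T \<union> S))"
    by (simp add: sum.cartesian_product case_prod_beta)
  also have "\<dots> \<le> (\<Sum>T\<in>unions k \<A> m. 2 ^ k * B * p ^ card T)"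
  proof (intro sum_mono)
    fix T assume "T \<in> unions k \<A> m"
    then have T: "finite T" "card T \<le> k" using unions_mem[of \<A> T k m] fin(2) by blast+
    have "(\<Sum>S\<in>\<A>. p ^ card (T \<union> S)) \<le>
        (\<Sum>S\<in>\<A>. \<Sum>U\<in>Pow T. if U \<subseteq> S then p ^ card T * p ^ card (S - U) else 0)"
    proof (intro sum_mono)
      fix S assume S: "S \<in> \<A>"
      have "card (T \<union> S) = card T + card (S - T \<inter> S)"
        using T fin(2)[OF S] by (simp add: card_Un_disjoint[symmetric] Diff_Int)
      then have "p ^ card (T \<union> S) = (if T \<inter> S \<subseteq> S then p ^ card T * p ^ card (S - T \<inter> S) else 0)"
        by (simp add: power_add)
      also have "\<dots> \<le> (\<Sum>U\<in>Pow T. if U \<subseteq> S then p ^ card T * p ^ card (S - U) else 0)"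
        using T p_pos by (intro member_le_sum) auto
      finally show "p ^ card (T \<union> S) \<le>
        (\<Sum>U\<in>Pow T. if U \<subseteq> S then p ^ card T * p ^ card (S - U) else 0)" .
    qed
    also have "\<dots> = (\<Sum>U\<in>Pow T. p ^ card T * (\<Sum>S | S \<in> \<A> \<and> U \<subseteq> S. p ^ card (S - U)))"
    proof -
      have "(\<Sum>U\<in>Pow T. \<Sum>S\<in>\<A>. if U \<subseteq> S then p ^ card T * p ^ card (S - U) else 0) =
          (\<Sum>U\<in>Pow T. p ^ card T * (\<Sum>S | S \<in> \<A> \<and> U \<subseteq> S. p ^ card (S - U)))"
        unfolding sum_distrib_left sum.inter_filter[OF fin(1)] by (intro sum.cong refl) simp
      then show ?thesis by (subst sum.swap)
    qed
    also have "\<dots> \<le> (\<Sum>U\<in>Pow T. p ^ card T * B)"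
      using p_pos T by (intro sum_mono mult_left_mono B) (auto intro: finite_subset)
    also have "\<dots> = 2 ^ card T * (B * p ^ card T)" using T by (simp add: card_Pow)
    also have "\<dots> \<le> 2 ^ k * (B * p ^ card T)"
      using T B0 p_pos by (intro mult_right_mono power_increasing) auto
    finally show "(\<Sum>S\<in>\<A>. p ^ card (T \<union> S)) \<le> 2 ^ k * B * p ^ card T" by simp
  qed
  also have "\<dots> \<le> 2 ^ k * B * (2 ^ k * B) ^ m"
    unfolding sum_distrib_left[symmetric] using Suc B0 by (intro mult_left_mono) auto
  finally show ?case by simp
qed simp

section \<open>Change of basis between characters and monomials\<close>

lemma prod_add_const:
  fixes g :: "'a \<Rightarrow> real"
  assumes "finite T"
  shows "(\<Prod>i\<in>T. g i + c) = (\<Sum>U\<in>Pow T. c ^ card (T - U) * (\<Prod>i\<in>U. g i))"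
  using assms
proof (induction T rule: finite_induct)
  case (insert i T)
  have *: "c ^ card (insert i T - U) * prod g U = c * (c ^ card (T - U) * prod g U)"
    "c ^ card (T - U) * prod g (insert i U) = g i * (c ^ card (T - U) * prod g U)"
    "insert i T - insert i U = T - U"
    if "U \<in> Pow T" for U
  proof -
    have U: "i \<notin> U" "finite U" using that insert.hyps finite_subset by auto
    have "insert i T - U = insert i (T - U)" using U by auto
    moreover show "insert i T - insert i U = T - U" using insert.hyps by auto
    ultimately show "c ^ card (insert i T - U) * prod g U = c * (c ^ card (T - U) * prod g U)"
      "c ^ card (T - U) * prod g (insert i U) = g i * (c ^ card (T - U) * prod g U)"
      using U insert.hyps by auto
  qed
  show ?case
    unfolding sum_Pow_insert[OF insert.hyps] using insert.hyps
    by (simp add: insert.IH * sum.distrib sum_distrib_left distrib_right)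
qed simp

lemma prod_of_bool: "finite U \<Longrightarrow> (\<Prod>i\<in>U. of_bool (i \<in> X)) = (of_bool (U \<subseteq> X) :: real)"
  by (induction U rule: finite_induct) auto

lemma phi_eq_sum:
  assumes "finite T"
  shows "phi T X = (\<Sum>U\<in>Pow T. (- p) ^ card (T - U) * of_bool (U \<subseteq> X))"
proof -
  have "phi T X = (\<Sum>U\<in>Pow T. (- p) ^ card (T - U) * (\<Prod>i\<in>U. of_bool (i \<in> X)))"
    unfolding phi_def using prod_add_const[OF assms, of "\<lambda>i. of_bool (i \<in> X)" "- p"] by simp
  also have "\<dots> = (\<Sum>U\<in>Pow T. (- p) ^ card (T - U) * of_bool (U \<subseteq> X))"
  proof (intro sum.cong refl)
    fix U assume "U \<in> Pow T"
    then have "finite U" using assms finite_subset by auto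
    then show "(- p) ^ card (T - U) * (\<Prod>i\<in>U. of_bool (i \<in> X)) = (- p) ^ card (T - U) * of_bool (U \<subseteq> X)"
      by (simp add: prod_of_bool)
  qed
  finally show ?thesis .
qed

lemma subset_eq_sum_phi:
  assumes "finite U"
  shows "of_bool (U \<subseteq> X) = (\<Sum>V\<in>Pow U. p ^ card (U - V) * phi V X)"
  using prod_add_const[OF assms, of "\<lambda>i. of_bool (i \<in> X) - p" p] assms
  by (simp add: phi_def prod_of_bool)

section \<open>Atoms of the partition by cores\<close>

definition core :: "'a set set \<Rightarrow> 'a set \<Rightarrow> 'a set" where
  "core \<H> X = \<Union> {H \<in> \<H>. H \<subseteq> X}"

lemma core_subset: "core \<H> X \<subseteq> X"
  by (auto simp: core_def)

text \<open>A union of members of the family that lies in X lies in the core of X. Hence the event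
  that a core is contained in X depends on X only through its own core.\<close>

lemma core_subset_iff: "core \<H> U \<subseteq> X \<longleftrightarrow> core \<H> U \<subseteq> core \<H> X"
  by (auto simp: core_def)

text \<open>
  Among the points above \<open>C\<close>, those with core \<open>C\<close> form a decreasing event, so conditioning on it
  does not increase the mean of \<open>F\<close>.
\<close>

lemma atom_harris:
  assumes fin: "finite N"
    and F: "\<And>X Y. X \<subseteq> Y \<Longrightarrow> Y \<subseteq> N \<Longrightarrow> F X \<le> F Y"
    and C: "C = core \<H> Y" "Y \<subseteq> N"
  shows "(\<Sum>X | X \<in> Pow N \<and> core \<H> X = C. wt N X * F X) \<le>
    (\<Sum>X | X \<in> Pow N \<and> core \<H> X = C. wt N X) * EE N (\<lambda>X. F (X \<union> C))"
proof -
  define G :: "'a set \<Rightarrow> real" where "G X = of_bool (\<forall>H\<in>\<H>. H \<subseteq> X \<longrightarrow> H \<subseteq> C)" for X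
  have CN: "C \<subseteq> N" unfolding C(1) by (rule order.trans[OF core_subset C(2)])
  have iff: "core \<H> X = C \<longleftrightarrow> C \<subseteq> X \<and> (\<forall>H\<in>\<H>. H \<subseteq> X \<longrightarrow> H \<subseteq> C)" for X
  proof
    assume "core \<H> X = C"
    then show "C \<subseteq> X \<and> (\<forall>H\<in>\<H>. H \<subseteq> X \<longrightarrow> H \<subseteq> C)"
      unfolding core_def by auto
  next
    assume *: "C \<subseteq> X \<and> (\<forall>H\<in>\<H>. H \<subseteq> X \<longrightarrow> H \<subseteq> C)"
    then have "core \<H> X \<subseteq> C" by (auto simp: core_def)
    moreover have "C \<subseteq> core \<H> X" using * core_subset_iff[of \<H> Y X] C by simp
    ultimately show "core \<H> X = C" by simp
  qed
  have atom: "(\<Sum>X | X \<in> Pow N \<and> core \<H> X = C. wt N X * K X) =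
      p ^ card C * EE N (\<lambda>X. K (X \<union> C) * G (X \<union> C))" for K
  proof -
    have "(\<Sum>X | X \<in> Pow N \<and> core \<H> X = C. wt N X * K X) =
        EE N (\<lambda>X. of_bool (C \<subseteq> X) * (K X * G X))"
      unfolding EE_def using fin by (intro sum.mono_neutral_cong_left) (auto simp: iff G_def)
    then show ?thesis using EE_superset[OF fin CN] by simp
  qed
  have "EE N (\<lambda>X. F (X \<union> C) * G (X \<union> C)) \<le> EE N (\<lambda>X. F (X \<union> C)) * EE N (\<lambda>X. G (X \<union> C))"
  proof (rule harris[OF fin])
    fix X Y assume XY: "X \<subseteq> Y" "Y \<subseteq> N"
    then have XY': "X \<union> C \<subseteq> Y \<union> C" by blast
    then show "F (X \<union> C) \<le> F (Y \<union> C)" using XY CN by (intro F) auto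
    show "G (Y \<union> C) \<le> G (X \<union> C)" using XY' by (auto simp: G_def dest: order.trans[OF _ XY'])
  qed
  then have "p ^ card C * EE N (\<lambda>X. F (X \<union> C) * G (X \<union> C)) \<le>
      p ^ card C * (EE N (\<lambda>X. F (X \<union> C)) * EE N (\<lambda>X. G (X \<union> C)))"
    using p_pos by (intro mult_left_mono) auto
  then show ?thesis using atom[of F] atom[of "\<lambda>_. 1"] by (simp add: mult_ac)
qed

text \<open>If no S works, every atom with a core of size at most M has mass a of F at most (1 -
  \<epsilon>) times its weight w, and then every constant misses F there by at least \<epsilon> *
  a.\<close>

lemma dense_link_exists:
  assumes fin: "finite N"
    and F01: "\<And>X. X \<subseteq> N \<Longrightarrow> F X = 0 \<or> F X = 1"
    and F_mono: "\<And>X Y. X \<subseteq> Y \<Longrightarrow> Y \<subseteq> N \<Longrightarrow> F X \<le> F Y"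
    and v: "\<And>X Y. X \<subseteq> N \<Longrightarrow> Y \<subseteq> N \<Longrightarrow> core \<H> X = core \<H> Y \<Longrightarrow> v X = v Y"
    and \<epsilon>: "0 < \<epsilon>" "\<epsilon> < 1"
    and approx: "EE N (\<lambda>X. (F X - v X)\<^sup>2) < \<epsilon> * EE N F / 2"
    and size: "EE N (\<lambda>X. real (card (core \<H> X))) \<le> M * EE N F / 2"
    and M: "0 < M"
  shows "\<exists>S\<subseteq>N. real (card S) \<le> M \<and> 1 - \<epsilon> \<le> EE N (\<lambda>X. F (X \<union> S))"
proof (rule ccontr)
  assume none: "\<not> ?thesis"
  let ?fib = "\<lambda>C. {X. X \<in> Pow N \<and> core \<H> X = C}"
  let ?c = "\<lambda>X. real (card (core \<H> X))"
  have fibres: "sum g (Pow N) = (\<Sum>C\<in>core \<H> ` Pow N. sum g (?fib C))" for g :: "'a set \<Rightarrow> real"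
    using fin by (intro sum.image_gen) simp
  \<comment> \<open>The factor 1 - card C / M is a linear lower bound for the indicator of cores of
    size at most M: it is negative on larger cores, so these need no estimate.\<close>
  have "(\<Sum>X\<in>Pow N. \<epsilon> * (wt N X * (F X - F X * ?c X / M))) \<le> (\<Sum>X\<in>Pow N. wt N X * (F X - v X)\<^sup>2)"
    unfolding fibres
  proof (rule sum_mono)
    fix C assume "C \<in> core \<H> ` Pow N"
    then obtain Y where Y: "C = core \<H> Y" "Y \<subseteq> N" by auto
    define a where "a = (\<Sum>X\<in>?fib C. wt N X * F X)"
    define w where "w = (\<Sum>X\<in>?fib C. wt N X)"
    have a0: "0 \<le> a" unfolding a_def
    proof (intro sum_nonneg)
      fix X assume "X \<in> ?fib C"
      then show "0 \<le> wt N X * F X" using F01[of X] less_imp_le[OF wt_pos] by auto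
    qed
    have lhs: "(\<Sum>X\<in>?fib C. \<epsilon> * (wt N X * (F X - F X * ?c X / M))) = \<epsilon> * (a * (1 - card C / M))"
      unfolding a_def sum_distrib_left sum_distrib_right
      by (intro sum.cong refl) (auto simp: algebra_simps)
    show "(\<Sum>X\<in>?fib C. \<epsilon> * (wt N X * (F X - F X * ?c X / M))) \<le>
        (\<Sum>X\<in>?fib C. wt N X * (F X - v X)\<^sup>2)"
    proof (cases "card C \<le> M")
      case False
      then have "1 - card C / M \<le> 0" using M by (simp add: field_simps)
      then have "\<epsilon> * (a * (1 - card C / M)) \<le> 0"
        using a0 \<epsilon> by (intro mult_nonneg_nonpos) auto
      also have "0 \<le> (\<Sum>X\<in>?fib C. wt N X * (F X - v X)\<^sup>2)"
        by (intro sum_nonneg mult_nonneg_nonneg zero_le_power2 less_imp_le[OF wt_pos])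
      finally show ?thesis unfolding lhs .
    next
      case True
      have "C \<subseteq> N" unfolding Y(1) by (rule order.trans[OF core_subset Y(2)])
      then have "\<not> 1 - \<epsilon> \<le> EE N (\<lambda>X. F (X \<union> C))" using none True by blast
      then have "EE N (\<lambda>X. F (X \<union> C)) \<le> 1 - \<epsilon>" by simp
      moreover have "0 \<le> w" unfolding w_def by (intro sum_nonneg less_imp_le wt_pos)
      moreover have "a \<le> w * EE N (\<lambda>X. F (X \<union> C))"
        unfolding a_def w_def by (rule atom_harris[OF fin F_mono Y])
      ultimately have a_le: "a \<le> w * (1 - \<epsilon>)" by (meson mult_left_mono order.trans)
      have "(\<Sum>X\<in>?fib C. wt N X * (F X - v X)\<^sup>2) =
          (\<Sum>X\<in>?fib C. (1 - 2 * v Y) * (wt N X * F X) + (v Y)\<^sup>2 * wt N X)"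
      proof (intro sum.cong refl)
        fix X assume "X \<in> ?fib C"
        then have X: "X \<subseteq> N" "v X = v Y" using v[of X Y] Y by auto
        show "wt N X * (F X - v X)\<^sup>2 = (1 - 2 * v Y) * (wt N X * F X) + (v Y)\<^sup>2 * wt N X"
          using F01[OF X(1)] X(2) by (auto simp: power2_eq_square algebra_simps)
      qed
      also have "\<dots> = (1 - 2 * v Y) * a + (v Y)\<^sup>2 * w"
        by (simp add: a_def w_def sum.distrib sum_distrib_left)
      finally have eq: "(\<Sum>X\<in>?fib C. wt N X * (F X - v X)\<^sup>2) = (1 - 2 * v Y) * a + (v Y)\<^sup>2 * w" .
      \<comment> \<open>Completing the square at v = 1 - \<epsilon>, the best constant when a = w *
        (1 - \<epsilon>). The factor 1 - \<epsilon> avoids a quotient and is cancelled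
        afterwards.\<close>
      have "(1 - \<epsilon>) * ((1 - 2 * v Y) * a + (v Y)\<^sup>2 * w) - (1 - \<epsilon>) * (\<epsilon> * a) =
          a * (1 - \<epsilon> - v Y)\<^sup>2 + (v Y)\<^sup>2 * (w * (1 - \<epsilon>) - a)"
        by (simp add: power2_eq_square algebra_simps)
      also have "\<dots> \<ge> 0" using a0 a_le by (intro add_nonneg_nonneg mult_nonneg_nonneg) auto
      finally have "(1 - \<epsilon>) * (\<epsilon> * a) \<le> (1 - \<epsilon>) * ((1 - 2 * v Y) * a + (v Y)\<^sup>2 * w)" by simp
      then have "\<epsilon> * a \<le> (1 - 2 * v Y) * a + (v Y)\<^sup>2 * w" using \<epsilon> by simp
      moreover have "\<epsilon> * (a * (1 - card C / M)) \<le> \<epsilon> * (a * 1)"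
        using a0 \<epsilon> M by (intro mult_left_mono) auto
      ultimately show ?thesis unfolding lhs eq by simp
    qed
  qed
  also have "\<dots> = EE N (\<lambda>X. (F X - v X)\<^sup>2)" by (simp add: EE_def)
  also have "(\<Sum>X\<in>Pow N. \<epsilon> * (wt N X * (F X - F X * ?c X / M))) =
      \<epsilon> * (EE N F - EE N (\<lambda>X. F X * ?c X / M))"
    unfolding EE_diff[symmetric] by (simp add: EE_def sum_distrib_left)
  finally have main: "\<epsilon> * (EE N F - EE N (\<lambda>X. F X * ?c X / M)) \<le> EE N (\<lambda>X. (F X - v X)\<^sup>2)" .
  have "EE N (\<lambda>X. F X * ?c X / M) \<le> EE N (\<lambda>X. 1 / M * ?c X)"
  proof (intro EE_mono)
    fix X assume "X \<subseteq> N"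
    then show "F X * ?c X / M \<le> 1 / M * ?c X" using F01[of X] M by auto
  qed
  also have "\<dots> \<le> EE N F / 2"
    unfolding EE_cmult using size M by (simp add: field_simps)
  finally have "\<epsilon> * (EE N F / 2) \<le> \<epsilon> * (EE N F - EE N (\<lambda>X. F X * ?c X / M))"
    using \<epsilon> by (intro mult_left_mono) auto
  then show False using main approx by simp
qed

end

section \<open>Approximation by a function of the core\<close>

context boolean_fn
begin

text \<open>The expected number of covered sets above V that lie in a random point, once V is
  planted.\<close>

definition deg :: "'a set \<Rightarrow> real" where
  "deg V = (\<Sum>T | T \<in> covered \<and> V \<subseteq> T. p ^ card (T - V))"

definition heavy :: "'a set set" where
  "heavy = {V. V \<subseteq> N \<and> \<eta> \<le> deg V}"

lemma finite_covered: "finite covered"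
  using fin by (auto simp: covered_def)

lemma coveredD:
  assumes "T \<in> covered"
  shows "T \<subseteq> N" "finite T" "card T \<le> k"
  using assms finN by (auto simp: covered_def)

lemma total_mass: "(\<Sum>T\<in>Pow N. s ^ card T * (d T)\<^sup>2) \<le> 1"
proof -
  have "(\<Sum>T\<in>Pow N. s ^ card T * (d T)\<^sup>2) = EE N (\<lambda>X. (poly N d X)\<^sup>2)"
    by (rule parseval[OF fin, symmetric])
  also have "\<dots> \<le> EE N (\<lambda>_. 1)"
  proof (rule EE_mono)
    fix X assume "X \<subseteq> N"
    then show "(poly N d X)\<^sup>2 \<le> 1" using F01[of X] F_poly[of X] by auto
  qed
  finally show ?thesis by (simp add: EE_const[OF fin])
qed

lemma up_dk_le: "up s N dk S \<le> up s N d S"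
  using s_pos by (intro up_mono) (auto simp: dk_def)

text \<open>
  The energy above \<open>U\<close> is at most \<open>(4 * p) ^ card U\<close> because iterated differences of a bounded
  function are bounded; hence every link of the family of active sets has bounded weight.
\<close>

lemma active_degree:
  assumes "finite U"
  shows "(\<Sum>S | S \<in> Collect active \<and> U \<subseteq> S. p ^ card (S - U)) \<le> 8 ^ k / \<delta> + 1"
proof (cases "U \<subseteq> N \<and> card U \<le> k")
  case False
  have "{S. S \<in> Collect active \<and> U \<subseteq> S} = {}"
  proof (rule equals0I)
    fix S assume "S \<in> {S. S \<in> Collect active \<and> U \<subseteq> S}"
    then have S: "S \<subseteq> N" "card S \<le> k" "U \<subseteq> S" by (auto simp: active_def)
    then show False using False card_mono[OF finN[OF S(1)] S(3)] by auto
  qed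
  then show ?thesis using \<delta>_pos by (simp only: sum.empty) simp
next
  case True
  \<comment> \<open>The term \<open>of_bool (S = {})\<close> pays for the empty set, which is active
    by convention and not by energy; it becomes the final summand 1.\<close>
  have "(\<Sum>S | S \<in> Collect active \<and> U \<subseteq> S. p ^ card (S - U)) \<le>
      (\<Sum>S | S \<subseteq> N \<and> U \<subseteq> S. of_bool (S = {}) + 1 / (\<delta> * p ^ card U) * up s N dk S)"
  proof (rule sum_le_included[where i = id])
    show "\<forall>x\<in>{S. S \<subseteq> N \<and> U \<subseteq> S}. 0 \<le> of_bool (x = {}) + 1 / (\<delta> * p ^ card U) * up s N dk x"
      using \<delta>_pos p_pos s_pos by (auto intro!: add_nonneg_nonneg divide_nonneg_pos up_nonneg)
    show "\<forall>x\<in>{S. S \<in> Collect active \<and> U \<subseteq> S}. \<exists>y\<in>{S. S \<subseteq> N \<and> U \<subseteq> S}. id y = x \<and>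
        p ^ card (x - U) \<le> of_bool (y = {}) + 1 / (\<delta> * p ^ card U) * up s N dk y"
    proof
      fix S assume "S \<in> {S. S \<in> Collect active \<and> U \<subseteq> S}"
      then have S: "active S" "S \<subseteq> N" "U \<subseteq> S" by (auto simp: active_def)
      have "p ^ card (S - U) \<le> of_bool (S = {}) + 1 / (\<delta> * p ^ card U) * up s N dk S"
      proof (cases "S = {}")
        case True
        then show ?thesis using \<delta>_pos p_pos s_pos by (auto intro!: divide_nonneg_pos up_nonneg)
      next
        case False
        then have "\<delta> \<le> (1 / p) ^ card S * up s N dk S" using S by (simp add: active_def)
        then have "p ^ card S * \<delta> \<le> p ^ card S * ((1 / p) ^ card S * up s N dk S)"
          using p_pos by (intro mult_left_mono) auto
        also have "\<dots> = up s N dk S" using p_pos by (simp add: power_divide)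
        finally have 1: "p ^ card S * \<delta> \<le> up s N dk S" .
        have "card S = card (S - U) + card U"
          using S finN[OF S(2)] assms by (simp add: card_Diff_subset card_mono)
        then have "p ^ card (S - U) * (\<delta> * p ^ card U) = p ^ card S * \<delta>" by (simp add: power_add)
        also note 1
        finally have "p ^ card (S - U) \<le> up s N dk S / (\<delta> * p ^ card U)"
          using \<delta>_pos p_pos by (subst pos_le_divide_eq) auto
        then show ?thesis using False by simp
      qed
      then show "\<exists>y\<in>{S. S \<subseteq> N \<and> U \<subseteq> S}. id y = S \<and>
        p ^ card (S - U) \<le> of_bool (y = {}) + 1 / (\<delta> * p ^ card U) * up s N dk y"
        using S by (intro bexI[of _ S]) auto
    qed
  qed (use fin finite_subset[of _ "Pow N"] in \<open>auto simp: active_def\<close>)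
  also have "\<dots> = (\<Sum>S | S \<subseteq> N \<and> U \<subseteq> S. of_bool (S = {})) +
      1 / (\<delta> * p ^ card U) * (\<Sum>S | S \<subseteq> N \<and> U \<subseteq> S. up s N dk S)"
    by (simp only: sum.distrib sum_distrib_left)
  also have "(\<Sum>S | S \<subseteq> N \<and> U \<subseteq> S. of_bool (S = {})) \<le> (1 :: real)"
  proof -
    have "finite {S. S \<subseteq> N \<and> U \<subseteq> S}" using fin by auto
    then show ?thesis unfolding of_bool_def by (subst sum.delta) auto
  qed
  also have "(\<Sum>S | S \<subseteq> N \<and> U \<subseteq> S. up s N dk S) \<le> 2 ^ k * up s N dk U"
    using s_pos by (intro sum_up_above[OF fin]) (auto simp: dk_def split: if_splits)
  also have "up s N dk U \<le> (4 * p) ^ card U"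
  proof -
    have "up s N dk U \<le> up s N d U" by (rule up_dk_le)
    also have "\<dots> \<le> (4 * s) ^ card U * 1\<^sup>2"
    proof (rule up_bound[OF fin])
      fix X assume "X \<subseteq> N"
      then show "\<bar>poly N d X\<bar> \<le> 1" using F01[of X] F_poly[of X] by auto
    qed (use True in simp)
    also have "\<dots> \<le> (4 * p) ^ card U" using s_le_p s_pos by (simp add: power_mono)
    finally show ?thesis .
  qed
  also have "1 / (\<delta> * p ^ card U) * (2 ^ k * (4 * p) ^ card U) = 2 ^ k * 4 ^ card U / \<delta>"
    using p_pos by (simp add: power_mult_distrib)
  also have "2 ^ k * 4 ^ card U / \<delta> \<le> 2 ^ k * 4 ^ k / \<delta>"
    using True \<delta>_pos by (intro divide_right_mono mult_left_mono power_increasing) auto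
  also have "(2::real) ^ k * 4 ^ k = 8 ^ k" unfolding power_mult_distrib[symmetric] by simp
  finally show ?thesis using \<delta>_pos p_pos by (simp add: add.commute divide_right_mono)
qed

text \<open>One active set for each element of T suffices, hence at most k of them. All partial
  unions stay inside T and respect the size cap, and the empty set pads their number to k.\<close>

lemma covered_unions: "covered \<subseteq> unions k (Collect active) k"
proof
  fix T assume T: "T \<in> covered"
  then have "\<forall>i\<in>T. \<exists>S. active S \<and> i \<in> S \<and> S \<subseteq> T" by (simp add: covered_def)
  then obtain S where S: "\<And>i. i \<in> T \<Longrightarrow> active (S i) \<and> i \<in> S i \<and> S i \<subseteq> T" by metis
  note cov = coveredD[OF T]
  have "\<Union> (S ` I) \<in> unions k (Collect active) (card I)" if "finite I" "I \<subseteq> T" for I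
    using that
  proof (induction I rule: finite_induct)
    case (insert i I)
    have "\<Union> (S ` I) \<union> S i \<subseteq> T" using S insert.prems by blast
    then have "card (\<Union> (S ` I) \<union> S i) \<le> k" using card_mono[OF cov(2)] cov(3) by (meson order.trans)
    moreover have "\<Union> (S ` I) \<in> unions k (Collect active) (card I)" "S i \<in> Collect active"
      using insert S[of i] by auto
    ultimately have "\<Union> (S ` I) \<union> S i \<in> unions k (Collect active) (Suc (card I))"
      unfolding unions.simps by blast
    moreover have "\<Union> (S ` insert i I) = \<Union> (S ` I) \<union> S i" by auto
    ultimately show ?case unfolding card_insert_disjoint[OF insert.hyps] by (simp only:)
  qed simp
  from this[OF cov(2) order.refl] have "\<Union> (S ` T) \<in> unions k (Collect active) (card T)" .
  moreover have "\<Union> (S ` T) = T" using S by blast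
  moreover have "unions k (Collect active) (card T) \<subseteq> unions k (Collect active) k"
    using cov finN k_pos by (intro unions_Suc) (auto simp: active_def)
  ultimately show "T \<in> unions k (Collect active) k" by auto
qed

lemma covered_weight: "(\<Sum>T\<in>covered. p ^ card T) \<le> (2 ^ k * (8 ^ k / \<delta> + 1)) ^ k"
proof -
  have A: "finite (Collect active)"
    by (rule finite_subset[of _ "Pow N"]) (auto simp: active_def fin)
  have "(\<Sum>T\<in>covered. p ^ card T) \<le> (\<Sum>T\<in>unions k (Collect active) k. p ^ card T)"
    using p_pos by (intro sum_mono2 finite_unions A covered_unions) auto
  also have "\<dots> \<le> (2 ^ k * (8 ^ k / \<delta> + 1)) ^ k"
    by (rule sum_unions[OF A _ active_degree]) (auto simp: active_def finN)
  finally show ?thesis .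
qed

lemma heavyD:
  assumes "V \<in> heavy"
  shows "V \<subseteq> N" "finite V" "card V \<le> k"
proof -
  show V: "V \<subseteq> N" "finite V" using assms finN by (auto simp: heavy_def)
  have "deg V \<noteq> 0" using assms \<eta>_pos by (auto simp: heavy_def)
  then obtain T where "T \<in> covered" "V \<subseteq> T"
    unfolding deg_def by (metis (mono_tags, lifting) mem_Collect_eq sum.neutral)
  then show "card V \<le> k" using coveredD[of T] card_mono[of T V] by linarith
qed

lemma finite_heavy: "finite heavy"
  using fin by (auto simp: heavy_def)

text \<open>Double counting of pairs of a heavy V inside a covered T: each V collects
  \<open>deg V * p ^ card V\<close>, and each T has at most 2 ^ k subsets.\<close>

lemma heavy_weight: "\<eta> * (\<Sum>V\<in>heavy. p ^ card V) \<le> 2 ^ k * (\<Sum>T\<in>covered. p ^ card T)"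
proof -
  have "\<eta> * (\<Sum>V\<in>heavy. p ^ card V) \<le> (\<Sum>V\<in>heavy. \<Sum>T\<in>covered. if V \<subseteq> T then p ^ card T else 0)"
    unfolding sum_distrib_left
  proof (rule sum_mono)
    fix V assume V: "V \<in> heavy"
    have "\<eta> * p ^ card V \<le> deg V * p ^ card V"
      using V p_pos by (intro mult_right_mono) (auto simp: heavy_def)
    also have "\<dots> = (\<Sum>T | T \<in> covered \<and> V \<subseteq> T. p ^ card T)"
      unfolding deg_def sum_distrib_right
    proof (intro sum.cong refl)
      fix T assume "T \<in> {T. T \<in> covered \<and> V \<subseteq> T}"
      then have T: "finite T" "V \<subseteq> T" using coveredD by auto
      have "card T = card (T - V) + card V"
        using T heavyD(2)[OF V] by (simp add: card_Diff_subset card_mono)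
      then show "p ^ card (T - V) * p ^ card V = p ^ card T" by (simp add: power_add)
    qed
    also have "\<dots> = (\<Sum>T\<in>covered. if V \<subseteq> T then p ^ card T else 0)"
      by (rule sum.inter_filter[OF finite_covered])
    finally show "\<eta> * p ^ card V \<le> (\<Sum>T\<in>covered. if V \<subseteq> T then p ^ card T else 0)" .
  qed
  also have "\<dots> = (\<Sum>T\<in>covered. \<Sum>V\<in>heavy. if V \<subseteq> T then p ^ card T else 0)"
    by (rule sum.swap)
  also have "\<dots> \<le> (\<Sum>T\<in>covered. 2 ^ k * p ^ card T)"
  proof (rule sum_mono)
    fix T assume "T \<in> covered"
    note T = coveredD[OF this]
    have "(\<Sum>V\<in>heavy. if V \<subseteq> T then p ^ card T else 0) = (\<Sum>V | V \<in> heavy \<and> V \<subseteq> T. p ^ card T)"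
      by (rule sum.inter_filter[OF finite_heavy, symmetric])
    also have "\<dots> \<le> (\<Sum>V\<in>Pow T. p ^ card T)"
      using T p_pos by (intro sum_mono2) auto
    also have "\<dots> = 2 ^ card T * p ^ card T" using T by (simp add: card_Pow)
    also have "\<dots> \<le> 2 ^ k * p ^ card T"
      using T p_pos by (intro mult_right_mono power_increasing) auto
    finally show "(\<Sum>V\<in>heavy. if V \<subseteq> T then p ^ card T else 0) \<le> 2 ^ k * p ^ card T" .
  qed
  finally show ?thesis by (simp only: sum_distrib_left)
qed

text \<open>Union bound: a heavy V lies in the point with probability \<open>p ^ card V\<close> and
  adds at most k elements to the core.\<close>

lemma EE_card_core:
  "EE N (\<lambda>X. real (card (core heavy X))) \<le> k * (\<Sum>V\<in>heavy. p ^ card V)"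
proof -
  have "EE N (\<lambda>X. real (card (core heavy X))) \<le> EE N (\<lambda>X. \<Sum>V\<in>heavy. real k * (of_bool (V \<subseteq> X) * 1))"
  proof (rule EE_mono)
    fix X assume "X \<subseteq> N"
    have "card (core heavy X) \<le> (\<Sum>V\<in>{V \<in> heavy. V \<subseteq> X}. card V)"
      unfolding core_def using card_UN_le[of "{V \<in> heavy. V \<subseteq> X}" "\<lambda>V. V"] finite_heavy by simp
    also have "\<dots> = (\<Sum>V\<in>heavy. if V \<subseteq> X then card V else 0)"
      by (rule sum.inter_filter[OF finite_heavy])
    also have "\<dots> \<le> (\<Sum>V\<in>heavy. k * of_bool (V \<subseteq> X))"
      using heavyD by (intro sum_mono) auto
    finally have "real (card (core heavy X)) \<le> real (\<Sum>V\<in>heavy. k * of_bool (V \<subseteq> X))"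
      by (rule of_nat_mono)
    then show "real (card (core heavy X)) \<le> (\<Sum>V\<in>heavy. real k * (of_bool (V \<subseteq> X) * 1))"
      by (simp only: of_nat_sum of_nat_mult of_nat_of_bool mult_1_right)
  qed
  also have "\<dots> = (\<Sum>V\<in>heavy. k * p ^ card V)"
    unfolding EE_sum EE_cmult
    by (intro sum.cong refl) (simp add: EE_superset[OF fin heavyD(1), of _ "\<lambda>_. 1", simplified] EE_const[OF fin])
  finally show ?thesis by (simp only: sum_distrib_left)
qed

text \<open>
  In the monomial expansion of \<open>phi T\<close> the indicator of \<open>U \<subseteq> X\<close> is replaced by its mean given the
  coordinates in the largest union of heavy sets inside \<open>U\<close>. The error then has no Fourier
  coefficient on heavy sets, and on the other sets Cauchy-Schwarz gains the factor \<open>\<eta>\<close>.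
\<close>

definition trace :: "'a set \<Rightarrow> 'a set \<Rightarrow> real" where
  "trace U X = p ^ card (U - core heavy U) * of_bool (core heavy U \<subseteq> X)"

definition approx :: "'a set \<Rightarrow> real" where
  "approx X = (\<Sum>T\<in>covered. d T * (\<Sum>U\<in>Pow T. (- p) ^ card (T - U) * trace U X))"

text \<open>The coefficient at \<open>phi V\<close> of the error made in replacing
  \<open>phi T\<close>. Taking the mean given the coordinates in \<open>core heavy U\<close> keeps
  exactly the characters supported there, hence the condition that V is not inside that
  core.\<close>

definition q :: "'a set \<Rightarrow> 'a set \<Rightarrow> real" where
  "q T V = (\<Sum>U\<in>Pow T. if V \<subseteq> U \<and> \<not> V \<subseteq> core heavy U
    then (- p) ^ card (T - U) * p ^ card (U - V) else 0)"

definition err :: "'a set \<Rightarrow> real" where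
  "err V = (\<Sum>T\<in>covered. d T * q T V)"

section \<open>Fourier coefficients of the approximation error\<close>

lemma approx_core: "core heavy X = core heavy Y \<Longrightarrow> approx X = approx Y"
  unfolding approx_def trace_def by (subst (1 2) core_subset_iff) simp

lemma q_eq_0: "\<not> V \<subseteq> T \<Longrightarrow> q T V = 0"
  unfolding q_def by (intro sum.neutral) auto

text \<open>A heavy V inside U belongs to the core of U by definition, so no U contributes.\<close>

lemma q_heavy: "V \<in> heavy \<Longrightarrow> q T V = 0"
  unfolding q_def core_def by (intro sum.neutral) auto

lemma abs_q_le:
  assumes "finite T" "V \<subseteq> T"
  shows "\<bar>q T V\<bar> \<le> 2 ^ card T * p ^ card (T - V)"
proof -
  have "\<bar>q T V\<bar> \<le> (\<Sum>U\<in>Pow T. p ^ card (T - V))"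
    unfolding q_def
  proof (rule order.trans[OF sum_abs sum_mono])
    fix U assume U: "U \<in> Pow T"
    show "\<bar>if V \<subseteq> U \<and> \<not> V \<subseteq> core heavy U then (- p) ^ card (T - U) * p ^ card (U - V) else 0\<bar>
        \<le> p ^ card (T - V)"
    proof (cases "V \<subseteq> U")
      case True
      have "T - V = (T - U) \<union> (U - V)" using U True by auto
      moreover have "card ((T - U) \<union> (U - V)) = card (T - U) + card (U - V)"
        using assms U finite_subset[of _ T] by (intro card_Un_disjoint) auto
      ultimately show ?thesis using p_pos by (simp add: abs_mult power_abs power_add)
    qed (use p_pos in simp)
  qed
  also have "\<dots> = 2 ^ card T * p ^ card (T - V)" using assms by (simp add: card_Pow)
  finally show ?thesis .
qed

lemma phi_minus_trace:
  assumes "T \<in> covered"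
  shows "phi T X - (\<Sum>U\<in>Pow T. (- p) ^ card (T - U) * trace U X) = (\<Sum>V\<in>Pow N. q T V * phi V X)"
proof -
  note T = coveredD[OF assms]
  have tr: "of_bool (U \<subseteq> X) - trace U X =
      (\<Sum>V\<in>Pow N. if V \<subseteq> U \<and> \<not> V \<subseteq> core heavy U then p ^ card (U - V) * phi V X else 0)"
    if "U \<in> Pow T" for U
  proof -
    let ?C = "core heavy U"
    have U: "finite U" "U \<subseteq> N" using that T finite_subset[of U T] by auto
    have C: "?C \<subseteq> U" by (rule core_subset)
    have C': "finite ?C" by (rule finite_subset[OF C U(1)])
    have "trace U X = (\<Sum>V\<in>Pow ?C. p ^ card (U - ?C) * (p ^ card (?C - V) * phi V X))"
      unfolding trace_def subset_eq_sum_phi[OF C'] by (rule sum_distrib_left)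
    also have "\<dots> = (\<Sum>V\<in>Pow ?C. p ^ card (U - V) * phi V X)"
    proof (intro sum.cong refl)
      fix V assume V: "V \<in> Pow ?C"
      have "U - V = (U - ?C) \<union> (?C - V)" using C V by auto
      moreover have "card ((U - ?C) \<union> (?C - V)) = card (U - ?C) + card (?C - V)"
        using U C' by (intro card_Un_disjoint) auto
      ultimately show "p ^ card (U - ?C) * (p ^ card (?C - V) * phi V X) = p ^ card (U - V) * phi V X"
        by (simp add: power_add)
    qed
    finally have "of_bool (U \<subseteq> X) - trace U X = (\<Sum>V\<in>Pow U - Pow ?C. p ^ card (U - V) * phi V X)"
      unfolding subset_eq_sum_phi[OF U(1)] using U C by (subst sum_diff) auto
    also have "\<dots> = (\<Sum>V\<in>Pow N. if V \<subseteq> U \<and> \<not> V \<subseteq> ?C then p ^ card (U - V) * phi V X else 0)"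
      using U fin by (intro sum.mono_neutral_cong_left) auto
    finally show ?thesis .
  qed
  have "phi T X - (\<Sum>U\<in>Pow T. (- p) ^ card (T - U) * trace U X) =
      (\<Sum>U\<in>Pow T. (- p) ^ card (T - U) * (of_bool (U \<subseteq> X) - trace U X))"
    unfolding phi_eq_sum[OF T(2)] sum_subtractf[symmetric] right_diff_distrib by (rule refl)
  also have "\<dots> = (\<Sum>U\<in>Pow T. \<Sum>V\<in>Pow N. (if V \<subseteq> U \<and> \<not> V \<subseteq> core heavy U
      then (- p) ^ card (T - U) * p ^ card (U - V) else 0) * phi V X)"
  proof (intro sum.cong refl)
    fix U assume U: "U \<in> Pow T"
    show "(- p) ^ card (T - U) * (of_bool (U \<subseteq> X) - trace U X) =
      (\<Sum>V\<in>Pow N. (if V \<subseteq> U \<and> \<not> V \<subseteq> core heavy U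
        then (- p) ^ card (T - U) * p ^ card (U - V) else 0) * phi V X)"
      unfolding tr[OF U] sum_distrib_left by (intro sum.cong refl) simp
  qed
  also have "\<dots> = (\<Sum>V\<in>Pow N. q T V * phi V X)"
    unfolding q_def sum_distrib_right by (rule sum.swap)
  finally show ?thesis .
qed

lemma diff_approx:
  assumes "X \<subseteq> N"
  shows "F X - approx X = poly N (\<lambda>T. if T \<in> covered then 0 else d T) X + poly N err X"
proof -
  have "poly N err X = (\<Sum>T\<in>covered. d T * (\<Sum>V\<in>Pow N. q T V * phi V X))"
    unfolding poly_def err_def sum_distrib_right sum_distrib_left
    by (subst sum.swap) (simp only: mult.assoc)
  also have "\<dots> = (\<Sum>T\<in>covered. d T * phi T X) - approx X"
    unfolding approx_def sum_subtractf[symmetric] right_diff_distrib[symmetric]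
    by (intro sum.cong refl) (simp only: phi_minus_trace)
  also have "(\<Sum>T\<in>covered. d T * phi T X) = (\<Sum>T\<in>Pow N. if T \<in> covered then d T * phi T X else 0)"
    using fin coveredD by (intro sum.mono_neutral_cong_left) auto
  also have "\<dots> = poly N d X - poly N (\<lambda>T. if T \<in> covered then 0 else d T) X"
    unfolding poly_def sum_subtractf[symmetric] by (intro sum.cong refl) simp
  finally show ?thesis using F_poly[OF assms] by simp
qed

text \<open>For V not heavy, the weight \<open>p ^ card (T - V)\<close> is split into two square
  roots; Cauchy-Schwarz gives \<open>deg V < \<eta>\<close> times a sum that turns into the energy
  above V by \<open>p \<le> 2 * s\<close>. The base 16 is 4 from the squared bound on q, 2 from this
  change of p to s, and 2 from \<open>sum_up\<close>.\<close>

lemma err_mass: "(\<Sum>V\<in>Pow N. s ^ card V * (err V)\<^sup>2) \<le> 16 ^ k * \<eta>"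
proof -
  have "(\<Sum>V\<in>Pow N. s ^ card V * (err V)\<^sup>2) \<le> (\<Sum>V\<in>Pow N. 8 ^ k * \<eta> * up s N dk V)"
  proof (rule sum_mono)
    fix V assume V: "V \<in> Pow N"
    show "s ^ card V * (err V)\<^sup>2 \<le> 8 ^ k * \<eta> * up s N dk V"
    proof (cases "V \<in> heavy")
      case True
      then have "err V = 0" by (simp add: err_def q_heavy)
      then show ?thesis using \<eta>_pos s_pos by (simp add: up_nonneg)
    next
      case False
      let ?A = "{T. T \<in> covered \<and> V \<subseteq> T}"
      let ?p = "\<lambda>T. p ^ card (T - V)"
      have A: "finite ?A" using finite_covered by simp
      have "err V = (\<Sum>T\<in>?A. d T * q T V)"
        unfolding err_def using finite_covered by (intro sum.mono_neutral_cong_right) (auto simp: q_eq_0)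
      then have "\<bar>err V\<bar> \<le> (\<Sum>T\<in>?A. \<bar>d T * q T V\<bar>)" by simp
      also have "\<dots> \<le> (\<Sum>T\<in>?A. 2 ^ k * (\<bar>d T\<bar> * sqrt (?p T) * sqrt (?p T)))"
      proof (rule sum_mono)
        fix T assume "T \<in> ?A"
        then have T: "finite T" "card T \<le> k" "V \<subseteq> T" using coveredD by auto
        have "\<bar>q T V\<bar> \<le> 2 ^ card T * ?p T" by (rule abs_q_le[OF T(1,3)])
        also have "\<dots> \<le> 2 ^ k * ?p T"
          using T p_pos by (intro mult_right_mono power_increasing) auto
        finally have "\<bar>d T\<bar> * \<bar>q T V\<bar> \<le> \<bar>d T\<bar> * (2 ^ k * ?p T)" by (intro mult_left_mono) auto
        also have "\<dots> = 2 ^ k * (\<bar>d T\<bar> * sqrt (?p T) * sqrt (?p T))" using p_pos by simp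
        finally show "\<bar>d T * q T V\<bar> \<le> 2 ^ k * (\<bar>d T\<bar> * sqrt (?p T) * sqrt (?p T))"
          by (simp only: abs_mult)
      qed
      finally have "\<bar>err V\<bar> \<le> 2 ^ k * (\<Sum>T\<in>?A. \<bar>d T\<bar> * sqrt (?p T) * sqrt (?p T))"
        by (simp only: sum_distrib_left)
      then have "\<bar>err V\<bar>\<^sup>2 \<le> (2 ^ k * (\<Sum>T\<in>?A. \<bar>d T\<bar> * sqrt (?p T) * sqrt (?p T)))\<^sup>2"
        by (rule power_mono) simp
      also have "\<dots> = 4 ^ k * (\<Sum>T\<in>?A. \<bar>d T\<bar> * sqrt (?p T) * sqrt (?p T))\<^sup>2"
      proof -
        have 4: "(4::real) ^ k = (2 ^ k)\<^sup>2"
          unfolding power2_eq_square power_mult_distrib[symmetric] by simp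
        show ?thesis unfolding 4 by (rule power_mult_distrib)
      qed
      also have "(\<Sum>T\<in>?A. \<bar>d T\<bar> * sqrt (?p T) * sqrt (?p T))\<^sup>2 \<le>
          (\<Sum>T\<in>?A. (\<bar>d T\<bar> * sqrt (?p T))\<^sup>2) * (\<Sum>T\<in>?A. (sqrt (?p T))\<^sup>2)"
        by (rule Cauchy_Schwarz_ineq_sum)
      also have "\<dots> = (\<Sum>T\<in>?A. (d T)\<^sup>2 * ?p T) * deg V"
        using p_pos by (simp add: power_mult_distrib deg_def)
      also have "\<dots> \<le> (\<Sum>T\<in>?A. (d T)\<^sup>2 * ?p T) * \<eta>"
        using False V p_pos by (intro mult_left_mono sum_nonneg) (auto simp: heavy_def)
      finally have "(err V)\<^sup>2 \<le> 4 ^ k * ((\<Sum>T\<in>?A. (d T)\<^sup>2 * ?p T) * \<eta>)" by simp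
      then have "s ^ card V * (err V)\<^sup>2 \<le> s ^ card V * (4 ^ k * ((\<Sum>T\<in>?A. (d T)\<^sup>2 * ?p T) * \<eta>))"
        using s_pos by (intro mult_left_mono) auto
      also have "\<dots> = 4 ^ k * \<eta> * (\<Sum>T\<in>?A. s ^ card V * ((d T)\<^sup>2 * ?p T))"
        unfolding sum_distrib_left[symmetric] by (simp only: mult_ac)
      also have "\<dots> \<le> 4 ^ k * \<eta> * (\<Sum>T\<in>?A. 2 ^ k * (s ^ card T * (d T)\<^sup>2))"
      proof (intro mult_left_mono sum_mono)
        fix T assume "T \<in> ?A"
        then have T: "finite T" "card T \<le> k" "V \<subseteq> T" using coveredD by auto
        have c: "card T = card V + card (T - V)"
          using T finite_subset[OF T(3)] by (simp add: card_Diff_subset card_mono)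
        have "?p T \<le> (2 * s) ^ card (T - V)" using p_le_2s p_pos by (intro power_mono) auto
        also have "\<dots> = 2 ^ card (T - V) * s ^ card (T - V)" by (rule power_mult_distrib)
        also have "\<dots> \<le> 2 ^ k * s ^ card (T - V)"
          using c T s_pos by (intro mult_right_mono power_increasing) auto
        finally have "s ^ card V * (d T)\<^sup>2 * ?p T \<le> s ^ card V * (d T)\<^sup>2 * (2 ^ k * s ^ card (T - V))"
          using s_pos by (intro mult_left_mono) auto
        then show "s ^ card V * ((d T)\<^sup>2 * ?p T) \<le> 2 ^ k * (s ^ card T * (d T)\<^sup>2)"
          unfolding c power_add by (simp only: mult_ac)
      qed (use \<eta>_pos in auto)
      also have "\<dots> = 8 ^ k * \<eta> * (\<Sum>T\<in>?A. s ^ card T * (d T)\<^sup>2)"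
      proof -
        have 8: "(8::real) ^ k = 4 ^ k * 2 ^ k" unfolding power_mult_distrib[symmetric] by simp
        show ?thesis unfolding 8 sum_distrib_left[symmetric] by (simp only: mult_ac)
      qed
      also have "\<dots> \<le> 8 ^ k * \<eta> * up s N dk V"
      proof (intro mult_left_mono)
        show "(\<Sum>T\<in>?A. s ^ card T * (d T)\<^sup>2) \<le> up s N dk V"
          unfolding up_def
        proof (rule sum_le_included[where i = id])
          show "\<forall>x\<in>?A. \<exists>y\<in>Pow N. id y = x \<and>
            s ^ card x * (d x)\<^sup>2 \<le> (if V \<subseteq> y then s ^ card y * (dk y)\<^sup>2 else 0)"
            using coveredD by (auto simp: dk_def)
        qed (use fin finite_covered s_pos in auto)
      qed (use \<eta>_pos in auto)
      finally show ?thesis .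
    qed
  qed
  also have "\<dots> = 8 ^ k * \<eta> * (\<Sum>V\<in>Pow N. up s N dk V)" by (simp only: sum_distrib_left)
  also have "(\<Sum>V\<in>Pow N. up s N dk V) \<le> 2 ^ k * (\<Sum>T\<in>Pow N. s ^ card T * (dk T)\<^sup>2)"
    using s_pos by (intro sum_up[OF fin]) (auto simp: dk_def split: if_splits)
  also have "(\<Sum>T\<in>Pow N. s ^ card T * (dk T)\<^sup>2) \<le> 1"
    using up_dk_le[of "{}"] total_mass by (simp add: up_empty)
  also have "8 ^ k * \<eta> * (2 ^ k * 1) = (16 :: real) ^ k * \<eta>"
  proof -
    have 16: "(16::real) ^ k = 8 ^ k * 2 ^ k" unfolding power_mult_distrib[symmetric] by simp
    show ?thesis unfolding 16 by simp
  qed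
  finally show ?thesis using \<eta>_pos by (simp add: mult_left_mono)
qed

lemma EE_diff_approx:
  "EE N (\<lambda>X. (F X - approx X)\<^sup>2) \<le>
    2 * ((1 / (2 * k) + 2 / t) * (\<Sum>j\<in>N. infl j)) + 2 * (16 ^ k * \<eta>)"
proof -
  let ?u = "\<lambda>T. if T \<in> covered then 0 else d T"
  have "EE N (\<lambda>X. (F X - approx X)\<^sup>2) \<le> EE N (\<lambda>X. 2 * (poly N ?u X)\<^sup>2 + 2 * (poly N err X)\<^sup>2)"
  proof (rule EE_mono)
    fix X assume "X \<subseteq> N"
    have "(a + b)\<^sup>2 \<le> 2 * a\<^sup>2 + 2 * b\<^sup>2" for a b :: real
      using sum_squares_bound[of a b] by (simp add: power2_sum)
    then show "(F X - approx X)\<^sup>2 \<le> 2 * (poly N ?u X)\<^sup>2 + 2 * (poly N err X)\<^sup>2"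
      unfolding diff_approx[OF \<open>X \<subseteq> N\<close>] .
  qed
  also have "\<dots> = 2 * (\<Sum>T\<in>Pow N. s ^ card T * (?u T)\<^sup>2) + 2 * (\<Sum>V\<in>Pow N. s ^ card V * (err V)\<^sup>2)"
    by (simp only: EE_linear parseval[OF fin])
  also have "(\<Sum>T\<in>Pow N. s ^ card T * (?u T)\<^sup>2) = (\<Sum>T\<in>Pow N - covered. s ^ card T * (d T)\<^sup>2)"
    using fin by (intro sum.mono_neutral_cong_right) auto
  finally show ?thesis using uncovered_mass err_mass by linarith
qed

end

section \<open>Translation from probability mass functions\<close>

text \<open>Passes from the set of coordinates equal to 1, the language of the proof, to the points
  used in the statement; planting becomes union.\<close>

definition char_fun :: "'a set \<Rightarrow> 'a \<Rightarrow> bool" where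
  "char_fun X = (\<lambda>i. i \<in> X)"

lemma inj_char_fun: "inj_on char_fun A"
  by (auto simp: inj_on_def char_fun_def fun_eq_iff)

lemma char_fun_Collect: "char_fun (Collect x) = x"
  by (simp add: char_fun_def)

context biased
begin

lemma set_mu: "set_pmf (mu n p) \<subseteq> char_fun ` Pow {1..n}"
proof
  fix x assume "x \<in> set_pmf (mu n p)"
  then have "\<forall>i. i \<notin> {1..n} \<longrightarrow> x i = False"
    unfolding mu_def using set_Pi_pmf_subset[of "{1..n}" False "\<lambda>_. bernoulli_pmf p"] by auto
  then show "x \<in> char_fun ` Pow {1..n}"
    by (intro image_eqI[of _ _ "Collect x"]) (auto simp: char_fun_Collect)
qed

lemma pmf_mu:
  assumes "X \<subseteq> {1..n}"
  shows "pmf (mu n p) (char_fun X) = wt {1..n} X"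
proof -
  have "pmf (mu n p) (char_fun X) = (\<Prod>i\<in>{1..n}. pmf (bernoulli_pmf p) (i \<in> X))"
    unfolding mu_def using assms by (subst pmf_Pi') (auto simp: char_fun_def)
  also have "\<dots> = (\<Prod>i\<in>{1..n}. if i \<in> X then p else 1 - p)"
    using p_pos p_le by (intro prod.cong) auto
  also have "\<dots> = (\<Prod>i\<in>X. p) * (\<Prod>i\<in>{1..n} - X. 1 - p)"
    using assms by (subst prod.If_cases) (auto simp: Int_absorb1 Diff_eq)
  finally show ?thesis by (simp add: wt_def)
qed

lemma expectation_mu:
  "measure_pmf.expectation (mu n p) g = EE {1..n} (\<lambda>X. g (char_fun X))"
proof -
  have "measure_pmf.expectation (mu n p) g = (\<Sum>x\<in>char_fun ` Pow {1..n}. g x * pmf (mu n p) x)"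
    using set_mu[of n] by (intro integral_measure_pmf_real) auto
  also have "\<dots> = (\<Sum>X\<in>Pow {1..n}. g (char_fun X) * pmf (mu n p) (char_fun X))"
    by (simp add: sum.reindex[OF inj_char_fun])
  also have "\<dots> = EE {1..n} (\<lambda>X. g (char_fun X))"
    unfolding EE_def by (intro sum.cong) (auto simp: pmf_mu)
  finally show ?thesis .
qed

lemma prob_mu_pair:
  "measure_pmf.prob (pair_pmf (mu n p) (mu n p)) {(x, y). R x y} =
    EE {1..n} (\<lambda>X. EE {1..n} (\<lambda>Y. of_bool (R (char_fun X) (char_fun Y))))"
proof -
  let ?P = "char_fun ` Pow {1..n}"
  have "measure_pmf.prob (pair_pmf (mu n p) (mu n p)) {(x, y). R x y} =
      measure_pmf.expectation (pair_pmf (mu n p) (mu n p)) (indicator {(x, y). R x y})"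
    by simp
  also have "\<dots> = (\<Sum>z\<in>?P \<times> ?P. indicator {(x, y). R x y} z * pmf (pair_pmf (mu n p) (mu n p)) z)"
    using set_mu[of n] by (intro integral_measure_pmf_real) auto
  also have "\<dots> = (\<Sum>x\<in>?P. \<Sum>y\<in>?P. of_bool (R x y) * (pmf (mu n p) x * pmf (mu n p) y))"
    unfolding sum.cartesian_product by (intro sum.cong) (auto simp: pmf_pair indicator_def)
  also have "\<dots> = (\<Sum>X\<in>Pow {1..n}. \<Sum>Y\<in>Pow {1..n}. of_bool (R (char_fun X) (char_fun Y)) *
      (pmf (mu n p) (char_fun X) * pmf (mu n p) (char_fun Y)))"
    by (simp add: sum.reindex[OF inj_char_fun])
  also have "\<dots> = EE {1..n} (\<lambda>X. EE {1..n} (\<lambda>Y. of_bool (R (char_fun X) (char_fun Y))))"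
    unfolding EE_def sum_distrib_left by (intro sum.cong) (auto simp: pmf_mu)
  finally show ?thesis .
qed

lemma expectation_cond_mu:
  assumes "S \<subseteq> {1..n}"
  shows "measure_pmf.expectation (cond_pmf (mu n p) {x. \<forall>i\<in>S. x i = True}) g =
    EE {1..n} (\<lambda>X. g (char_fun (X \<union> S)))"
proof -
  let ?A = "{x :: nat \<Rightarrow> bool. \<forall>i\<in>S. x i = True}" and ?P = "char_fun ` Pow {1..n}"
  have mem: "char_fun X \<in> ?A \<longleftrightarrow> S \<subseteq> X" for X by (auto simp: char_fun_def)
  \<comment> \<open>The all-ones point shows that the conditioning event has positive probability,
    without which \<open>cond_pmf\<close> is unspecified.\<close>
  have "0 < pmf (mu n p) (char_fun {1..n})" by (simp add: pmf_mu wt_pos)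
  then have "char_fun {1..n} \<in> set_pmf (mu n p)" by (simp add: set_pmf_iff)
  then have ne: "set_pmf (mu n p) \<inter> ?A \<noteq> {}" using assms mem by blast
  have "measure_pmf.prob (mu n p) ?A = measure_pmf.expectation (mu n p) (indicator ?A)" by simp
  also have "\<dots> = EE {1..n} (\<lambda>X. of_bool (S \<subseteq> X) * 1)"
    unfolding expectation_mu indicator_def mem by simp
  also have "\<dots> = p ^ card S"
    using EE_superset[OF _ assms, of "\<lambda>_. 1"] by (simp add: EE_const)
  finally have pr: "measure_pmf.prob (mu n p) ?A = p ^ card S" .
  have supp: "set_pmf (cond_pmf (mu n p) ?A) \<subseteq> ?P"
    unfolding set_cond_pmf[OF ne] using set_mu by blast
  have "measure_pmf.expectation (cond_pmf (mu n p) ?A) g =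
      (\<Sum>x\<in>?P. g x * pmf (cond_pmf (mu n p) ?A) x)"
    by (rule integral_measure_pmf_real) (use supp in blast)+
  also have "\<dots> = (\<Sum>X\<in>Pow {1..n}. g (char_fun X) * pmf (cond_pmf (mu n p) ?A) (char_fun X))"
    by (simp add: sum.reindex[OF inj_char_fun])
  also have "\<dots> = (1 / p ^ card S) * EE {1..n} (\<lambda>X. of_bool (S \<subseteq> X) * g (char_fun X))"
    unfolding EE_def sum_distrib_left pmf_cond[OF ne] pr mem
    by (intro sum.cong) (auto simp: pmf_mu)
  also have "\<dots> = EE {1..n} (\<lambda>X. g (char_fun (X \<union> S)))"
    using EE_superset[OF _ assms, of "\<lambda>X. g (char_fun X)"] p_pos by simp
  finally show ?thesis .
qed

lemma mono_char_fun:
  assumes "increasing_on_cube n f" "X \<subseteq> Y" "Y \<subseteq> {1..n}"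
  shows "f (char_fun X) \<le> f (char_fun Y)"
proof -
  have "char_fun X \<in> cube n" "char_fun Y \<in> cube n"
    using assms by (auto simp: cube_def PiE_dflt_def char_fun_def)
  moreover have "\<forall>i\<in>{1..n}. char_fun X i \<le> char_fun Y i" using assms by (auto simp: char_fun_def)
  ultimately show ?thesis using assms(1) unfolding increasing_on_cube_def by blast
qed

text \<open>Where the derivative is 1, the value of f changes exactly when the old and the new
  coordinate differ, which has probability 2 * p * (1 - p). Averaging over coordinate j of y and
  then of x makes this explicit.\<close>

lemma influence_eq:
  assumes j: "j \<in> {1..n}" and f: "increasing_on_cube n f"
  shows "influence n p f j = 2 * s * EE {1..n} (deriv j (\<lambda>X. of_bool (f (char_fun X))))"
proof -
  let ?N = "{1..n}" and ?f = "\<lambda>X. f (char_fun X)"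
  have upd: "(char_fun X)(j := char_fun Y j) = char_fun (if j \<in> Y then insert j X else X - {j})" for X Y
    by (auto simp: char_fun_def fun_eq_iff)
  have inner: "EE ?N (\<lambda>Y. of_bool (?f X \<noteq> f ((char_fun X)(j := char_fun Y j)))) =
      (1 - p) * of_bool (?f X \<noteq> ?f (X - {j})) + p * of_bool (?f X \<noteq> ?f (insert j X))" for X
    using j unfolding upd by (subst EE_remove[where j = j]) (simp_all add: EE_const)
  have "influence n p f j =
      EE ?N (\<lambda>X. (1 - p) * of_bool (?f X \<noteq> ?f (X - {j})) + p * of_bool (?f X \<noteq> ?f (insert j X)))"
    unfolding influence_def prob_mu_pair inner by (rule refl)
  also have "\<dots> = EE ?N (\<lambda>X. 2 * s * deriv j (\<lambda>X. of_bool (?f X)) X)"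
  proof (subst EE_remove[where j = j])
    show "EE ?N (\<lambda>X. (1 - p) * ((1 - p) * of_bool (?f (X - {j}) \<noteq> ?f (X - {j} - {j})) +
          p * of_bool (?f (X - {j}) \<noteq> ?f (insert j (X - {j})))) +
        p * ((1 - p) * of_bool (?f (insert j X) \<noteq> ?f (insert j X - {j})) +
          p * of_bool (?f (insert j X) \<noteq> ?f (insert j (insert j X))))) =
      EE ?N (\<lambda>X. 2 * s * deriv j (\<lambda>X. of_bool (?f X)) X)"
    proof (intro EE_cong)
      fix X assume X: "X \<subseteq> ?N"
      have "?f (X - {j}) \<le> ?f (insert j X)"
        using X j by (intro mono_char_fun[OF f]) auto
      then show "(1 - p) * ((1 - p) * of_bool (?f (X - {j}) \<noteq> ?f (X - {j} - {j})) +
          p * of_bool (?f (X - {j}) \<noteq> ?f (insert j (X - {j})))) +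
        p * ((1 - p) * of_bool (?f (insert j X) \<noteq> ?f (insert j X - {j})) +
          p * of_bool (?f (insert j X) \<noteq> ?f (insert j (insert j X)))) =
        2 * s * deriv j (\<lambda>X. of_bool (?f X)) X"
        by (auto simp: deriv_def s_def)
    qed
  qed (use j in auto)
  finally show ?thesis by (simp only: EE_cmult)
qed

end

section \<open>Choice of parameters\<close>

text \<open>All bounds are converted to powers of 2. The k-th power in the bound on Z, taken of a
  quantity exponential in k, is what makes the exponent quadratic.\<close>

lemma core_size_numeric:
  fixes k :: nat and \<alpha> \<delta> \<eta> Z W :: real
  assumes k: "1 \<le> k" and \<alpha>: "4 / k \<le> \<alpha>"
    and \<delta>: "\<delta> = 1 / (4 * 32 ^ (4 * k))" and \<eta>: "\<eta> = 1 / 64 ^ k"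
    and Z: "Z \<le> (2 ^ k * (8 ^ k / \<delta> + 1)) ^ k"
    and W: "\<eta> * W \<le> 2 ^ k * Z"
  shows "k * W \<le> 2 ^ (36 * k\<^sup>2) * \<alpha> / 2"
proof -
  have two: "(8::real) = 2 ^ 3" "(32::real) = 2 ^ 5" "(64::real) = 2 ^ 6" "(4::real) = 2 ^ 2" by simp_all
  \<comment> \<open>The exponent is 3 * k from 8 ^ k, and 20 * k + 2 from 1 / \<delta>.\<close>
  have "8 ^ k / \<delta> + 1 = 2 ^ (23 * k + 2) + (1::real)"
    unfolding \<delta> two power_mult[symmetric] by (simp add: power_add power_mult flip: power_mult_distrib)
  also have "\<dots> \<le> 2 ^ (23 * k + 2) + 2 ^ (23 * k + 2)" by (intro add_left_mono one_le_power) simp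
  also have "\<dots> = 2 ^ (23 * k + 3)" by (simp add: power_add)
  also have "\<dots> \<le> 2 ^ (26 * k)" using k by (intro power_increasing) auto
  finally have "2 ^ k * (8 ^ k / \<delta> + 1) \<le> 2 ^ k * 2 ^ (26 * k)" by (intro mult_left_mono) auto
  also have "\<dots> = 2 ^ (27 * k)" by (simp flip: power_add)
  finally have "(2 ^ k * (8 ^ k / \<delta> + 1)) ^ k \<le> (2 ^ (27 * k)) ^ k"
    by (intro power_mono) (auto simp: \<delta>)
  also have "\<dots> = 2 ^ (27 * k\<^sup>2)" by (simp add: power2_eq_square mult.assoc flip: power_mult)
  finally have Z': "Z \<le> 2 ^ (27 * k\<^sup>2)" using Z by linarith
  have k2: "k \<le> k\<^sup>2" using k by (simp add: power2_eq_square)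
  have kpow: "real k \<le> 2 ^ k\<^sup>2"
  proof -
    have "k < 2 ^ k" by (rule less_exp)
    then have "real k \<le> 2 ^ k" by (metis less_imp_le of_nat_le_iff of_nat_numeral of_nat_power)
    also have "\<dots> \<le> 2 ^ k\<^sup>2" using k2 by (intro power_increasing) auto
    finally show ?thesis .
  qed
  have "W = 64 ^ k * (\<eta> * W)" unfolding \<eta> by simp
  also have "\<dots> \<le> 64 ^ k * (2 ^ k * 2 ^ (27 * k\<^sup>2))"
    using W Z' by (intro mult_left_mono order.trans[OF W]) auto
  also have "\<dots> = 2 ^ (7 * k + 27 * k\<^sup>2)"
    unfolding two power_mult[symmetric] power_add[symmetric] by (rule arg_cong[where f = "power 2"]) simp
  also have "\<dots> \<le> 2 ^ (34 * k\<^sup>2)" using k2 by (intro power_increasing) auto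
  finally have W': "W \<le> 2 ^ (34 * k\<^sup>2)" .
  \<comment> \<open>The factor k / 2 is included because the target contains \<alpha> / 2, which is
    only known to be at least 2 / k.\<close>
  have "k * W * (k / 2) \<le> real k * 2 ^ (34 * k\<^sup>2) * (k / 2)"
    by (rule mult_right_mono[OF mult_left_mono[OF W']]) simp_all
  also have "\<dots> \<le> 2 ^ k\<^sup>2 * 2 ^ (34 * k\<^sup>2) * 2 ^ k\<^sup>2"
  proof -
    have "real k / 2 \<le> 2 ^ k\<^sup>2" using kpow by linarith
    from mult_mono[OF mult_mono[OF kpow order.refl] this] show ?thesis by simp
  qed
  also have "\<dots> = 2 ^ (36 * k\<^sup>2)"
    unfolding power_add[symmetric] by (rule arg_cong[where f = "power 2"]) simp
  finally have "k * W * (k / 2) * (2 / k) \<le> 2 ^ (36 * k\<^sup>2) * (2 / k)"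
    by (intro mult_right_mono) auto
  then have "k * W \<le> 2 ^ (36 * k\<^sup>2) * (2 / k)" using k by simp
  also have "\<dots> \<le> 2 ^ (36 * k\<^sup>2) * (\<alpha> / 2)" using \<alpha> by (intro mult_left_mono) auto
  finally show ?thesis by simp
qed

context biased
begin

text \<open>The bound L on total influence is an integer, so it is either nonpositive, where F is
  constant, or at least 1. The latter gives D at least 1 and allows roundings in k to be absorbed
  into a multiple of D.\<close>

lemma bounded_dense_link:
  fixes F :: "'a set \<Rightarrow> real" and L :: int
  assumes fin: "finite N"
    and F01: "\<And>X. X \<subseteq> N \<Longrightarrow> F X = 0 \<or> F X = 1"
    and F_mono: "\<And>X Y. X \<subseteq> Y \<Longrightarrow> Y \<subseteq> N \<Longrightarrow> F X \<le> F Y"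
    and \<alpha>: "\<alpha> = EE N F" "0 < \<alpha>"
    and \<epsilon>: "0 < \<epsilon>" "\<epsilon> < 1"
    and L: "(\<Sum>j\<in>N. 2 * s * EE N (deriv j F)) \<le> of_int L"
  shows "\<exists>S\<subseteq>N. real (card S) \<le> exp (10 ^ 12 * (of_int L / (\<alpha> * \<epsilon>))\<^sup>2) \<and>
    1 - \<epsilon> \<le> EE N (\<lambda>X. F (X \<union> S))"
proof -
  from poly_expansion[OF fin, of F] obtain d where "\<forall>X\<subseteq>N. F X = poly N d X" ..
  then have d: "X \<subseteq> N \<Longrightarrow> F X = poly N d X" for X by simp
  have \<alpha>1: "\<alpha> \<le> 1"
  proof -
    have "EE N F \<le> EE N (\<lambda>_. 1)"
    proof (rule EE_mono)
      fix X assume "X \<subseteq> N"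
      then show "F X \<le> 1" using F01[of X] by auto
    qed
    then show ?thesis using \<alpha> by (simp add: EE_const[OF fin])
  qed
  show ?thesis
  proof (cases "L \<le> 0")
    case True
    \<comment> \<open>Placeholder parameters satisfying the locale equation 4 * 32 / 128 = 1; only
      the Fourier formula for influences is wanted. It makes all nonempty coefficients vanish, so F
      is constant, and equal to 1 because \<alpha> is positive.\<close>
    interpret boolean_fn p N F d 1 1 "1 / 128" 1
      by unfold_locales (use fin F01 F_mono d in auto)
    have "(\<Sum>j\<in>N. infl j) \<le> 0" using L True unfolding infl_def by linarith
    then have inf0: "infl j = 0" if "j \<in> N" for j
      using that infl_nonneg fin by (metis dual_order.antisym sum_nonneg sum_nonneg_0)
    have d0: "d T = 0" if T: "T \<subseteq> N" "T \<noteq> {}" for T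
    proof -
      obtain j where j: "j \<in> T" using T by auto
      then have "(\<Sum>T\<in>Pow N. if j \<in> T then s ^ card T * (d T)\<^sup>2 else 0) = 0"
        using inf0 infl_eq_sum T by auto
      then have "\<forall>T\<in>Pow N. (if j \<in> T then s ^ card T * (d T)\<^sup>2 else 0) = 0"
        using fin s_pos by (subst (asm) sum_nonneg_eq_0_iff) auto
      from bspec[OF this, of T] show ?thesis using j T s_pos by simp
    qed
    have const: "F X = d {}" if "X \<subseteq> N" for X
    proof -
      have "poly N d X = (\<Sum>T\<in>{{}}. d T * phi T X)"
        unfolding poly_def using fin d0 by (intro sum.mono_neutral_right) auto
      then show ?thesis using d[OF that] by (simp add: phi_def)
    qed
    have "\<alpha> = EE N (\<lambda>_. d {})" unfolding \<alpha>(1) by (rule EE_cong[OF const])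
    then have "\<alpha> = d {}" by (simp add: EE_const[OF fin])
    moreover have "d {} = 0 \<or> d {} = 1" using const[of "{}"] F01[of "{}"] by simp
    ultimately have "\<alpha> = 1" using \<alpha>(2) by auto
    then show ?thesis using \<alpha>(1) \<epsilon> by (intro exI[of _ "{}"]) auto
  next
    case False
    define D where "D = of_int L / (\<alpha> * \<epsilon>)"
    \<comment> \<open>With k at least 4 * D, total influence is at most k * \<alpha> * \<epsilon> /
      4, so the high-degree tail costs about \<alpha> * \<epsilon> / 4 of the permitted \<alpha> *
      \<epsilon> / 2.\<close>
    define k where "k = nat \<lceil>4 * D\<rceil>"
    have ae: "0 < \<alpha> * \<epsilon>" "\<alpha> * \<epsilon> \<le> \<alpha>" "\<alpha> * \<epsilon> \<le> 1"
      using \<alpha>(2) \<alpha>1 \<epsilon> by (auto simp: mult_le_one)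
    have L1: "1 \<le> real_of_int L" using False by simp
    have D1: "1 / (\<alpha> * \<epsilon>) \<le> D" unfolding D_def using L1 ae by (intro divide_right_mono) auto
    moreover have "1 \<le> 1 / (\<alpha> * \<epsilon>)" using ae by simp
    ultimately have D: "1 \<le> D" by linarith
    have k: "4 * D \<le> k" "k \<le> 4 * D + 1" using D by (auto simp: k_def; linarith)+
    then have k4: "4 \<le> k" using D by linarith
    have aek: "4 / k \<le> \<alpha> * \<epsilon>"
    proof -
      have "4 * (1 / (\<alpha> * \<epsilon>)) \<le> k" using k D1 by linarith
      then show ?thesis using ae k4 by (simp add: field_simps)
    qed
    \<comment> \<open>This t makes 2 / t small against 1 / (2 * k), and \<delta> is then forced by
      the locale equation. The value of \<eta> beats the 16 ^ k of \<open>err_mass\<close> by 4 ^ k,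
      enough since \<alpha> * \<epsilon> is at least 4 / k.\<close>
    define t :: real where "t = 32 ^ k"
    define \<delta> :: real where "\<delta> = 1 / (4 * 32 ^ (4 * k))"
    define \<eta> :: real where "\<eta> = 1 / 64 ^ k"
    interpret boolean_fn p N F d k t \<delta> \<eta>
    proof unfold_locales
      have "4 * 32 ^ k * t ^ 3 = 4 * (32::real) ^ (4 * k)"
        unfolding t_def power_mult[symmetric] mult.assoc power_add[symmetric] by (simp add: mult.commute)
      then show "4 * 32 ^ k * t ^ 3 * \<delta> = 1" by (simp add: \<delta>_def)
    qed (use fin F01 F_mono d k4 in \<open>auto simp: t_def \<eta>_def\<close>)
    have 2: "real k \<le> 2 ^ k" by (rule less_imp_le[OF of_nat_less_two_power])
    have small: "64 * real k \<le> t"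
    proof -
      have "64 * real k \<le> 16 ^ k * 2 ^ k"
        using k4 2 power_increasing[of 2 k "16 :: real"] by (intro mult_mono) auto
      also have "\<dots> = t" unfolding t_def power_mult_distrib[symmetric] by simp
      finally show ?thesis .
    qed
    have I: "(\<Sum>j\<in>N. infl j) \<le> k * (\<alpha> * \<epsilon>) / 4"
    proof -
      have "(\<Sum>j\<in>N. infl j) \<le> D * (\<alpha> * \<epsilon>)" using L \<alpha>(2) \<epsilon>(1) by (simp add: infl_def D_def)
      also have "\<dots> \<le> k / 4 * (\<alpha> * \<epsilon>)" using k ae by (intro mult_right_mono) auto
      finally show ?thesis by simp
    qed
    have approx: "EE N (\<lambda>X. (F X - approx X)\<^sup>2) < \<epsilon> * EE N F / 2"
    proof -
      have "2 * ((1 / (2 * k) + 2 / t) * (\<Sum>j\<in>N. infl j)) \<le>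
          2 * ((1 / (2 * k) + 2 / (64 * k)) * (k * (\<alpha> * \<epsilon>) / 4))"
        using I small k4 ae by (intro mult_left_mono mult_mono add_left_mono divide_left_mono sum_nonneg infl_nonneg)
          (auto simp: t_def)
      also have "\<dots> = 17 / 64 * (\<alpha> * \<epsilon>)" using k4 by (simp add: field_simps)
      finally have "2 * ((1 / (2 * k) + 2 / t) * (\<Sum>j\<in>N. infl j)) \<le> 17 / 64 * (\<alpha> * \<epsilon>)" .
      moreover have "2 * (16 ^ k * \<eta>) \<le> \<alpha> * \<epsilon> / 8"
      proof -
        have "(64 :: real) ^ k = 16 ^ k * (2 ^ k * 2 ^ k)"
          unfolding power_mult_distrib[symmetric] by simp
        then have "2 * (16 ^ k * \<eta>) = 2 / (2 ^ k * 2 ^ k)" by (simp add: \<eta>_def)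
        also have "\<dots> \<le> 2 / (4 * k)"
        proof (rule divide_left_mono)
          have "4 \<le> (2 :: real) ^ k" using k4 power_increasing[of 2 k "2 :: real"] by simp
          from mult_mono[OF this 2] show "real (4 * k) \<le> 2 ^ k * 2 ^ k" by simp
        qed (use k4 in auto)
        also have "\<dots> = 4 / k / 8" by simp
        also have "\<dots> \<le> \<alpha> * \<epsilon> / 8" using aek by (rule divide_right_mono) simp
        finally show ?thesis .
      qed
      \<comment> \<open>The two parts of the error add up to 17 / 64 + 8 / 64 = 25 / 64 of \<alpha>
        * \<epsilon>.\<close>
      ultimately have "EE N (\<lambda>X. (F X - approx X)\<^sup>2) < \<alpha> * \<epsilon> / 2"
        using EE_diff_approx ae by linarith
      then show ?thesis by (simp add: \<alpha>(1) mult.commute)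
    qed
    define M :: real where "M = 2 ^ (36 * k\<^sup>2)"
    have "k * (\<Sum>V\<in>heavy. p ^ card V) \<le> M * \<alpha> / 2"
      unfolding M_def
    proof (rule core_size_numeric[OF _ _ \<delta>_def \<eta>_def covered_weight heavy_weight])
      show "4 / k \<le> \<alpha>" using aek ae by linarith
    qed (use k4 in simp)
    then have size: "EE N (\<lambda>X. real (card (core heavy X))) \<le> M * EE N F / 2"
      using EE_card_core unfolding \<alpha>(1) by linarith
    have "\<exists>S\<subseteq>N. real (card S) \<le> M \<and> 1 - \<epsilon> \<le> EE N (\<lambda>X. F (X \<union> S))"
    proof (rule dense_link_exists[OF fin F01 F_mono _ \<epsilon> approx size])
      show "core heavy X = core heavy Y \<Longrightarrow> approx X = approx Y" for X Y by (rule approx_core)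
    qed (simp_all add: M_def)
    then obtain S where S: "S \<subseteq> N" "real (card S) \<le> M" "1 - \<epsilon> \<le> EE N (\<lambda>X. F (X \<union> S))"
      by blast
    have "M \<le> exp 1 ^ (36 * k\<^sup>2)"
      unfolding M_def using exp_ge_add_one_self[of 1] by (intro power_mono) auto
    also have "\<dots> = exp (36 * (real k)\<^sup>2)" by (simp flip: exp_of_nat_mult)
    also have "\<dots> \<le> exp (10 ^ 12 * D\<^sup>2)"
    proof -
      \<comment> \<open>Since D is at least 1, k is at most 4 * D + 1 and hence at most 5 * D; 36 *
        25 = 900 is well within 10 ^ 12.\<close>
      have "(real k)\<^sup>2 \<le> (5 * D)\<^sup>2" using k D by (intro power_mono) auto
      then have "36 * (real k)\<^sup>2 \<le> 900 * D\<^sup>2" by (simp add: power_mult_distrib)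
      also have "\<dots> \<le> 10 ^ 12 * D\<^sup>2" by (intro mult_right_mono) auto
      finally show ?thesis by simp
    qed
    finally have "real (card S) \<le> exp (10 ^ 12 * D\<^sup>2)" using S(2) by linarith
    then show ?thesis using S(1,3) unfolding D_def by blast
  qed
qed

end

theorem corollary2p10:
  fixes p \<epsilon> \<alpha> :: real and n :: nat and f :: "(nat \<Rightarrow> bool) \<Rightarrow> bool"
  assumes "0 < p" and "p \<le> 1 / 2"
    and "n \<ge> 1"
    and "increasing_on_cube n f"
    and "\<alpha> = measure_pmf.expectation (mu n p) (\<lambda>x. of_bool (f x))"
    and "\<alpha> > 0"
    and "\<epsilon> > 0"
  shows "\<exists>S. S \<subseteq> {1..n} \<and>
    real (card S) \<le>
      exp (10 ^ 12 * (real_of_int \<lceil>total_influence n p f\<rceil>)\<^sup>2 * \<alpha> powi (-2) * \<epsilon> powi (-2)) \<and>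
    measure_pmf.expectation (cond_pmf (mu n p) {x. \<forall>i\<in>S. x i = True}) (\<lambda>x. of_bool (f x))
      \<ge> 1 - \<epsilon>"
proof -
  interpret biased p by unfold_locales (fact assms)+
  define F :: "nat set \<Rightarrow> real" where "F X = of_bool (f (char_fun X))" for X
  have cond: "measure_pmf.expectation (cond_pmf (mu n p) {x. \<forall>i\<in>S. x i = True}) (\<lambda>x. of_bool (f x)) =
      EE {1..n} (\<lambda>X. F (X \<union> S))" if "S \<subseteq> {1..n}" for S
    unfolding F_def by (rule expectation_cond_mu[OF that])
  show ?thesis
  proof (cases "\<epsilon> < 1")
    case False
    \<comment> \<open>For \<epsilon> at least 1 the required mean is nonpositive and the empty set
      serves.\<close>
    have "0 \<le> EE {1..n} (\<lambda>X. F (X \<union> {}))" by (rule EE_nonneg) (simp add: F_def)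
    then show ?thesis using False cond[of "{}"] by (intro exI[of _ "{}"]) auto
  next
    case True
    have "(\<Sum>j\<in>{1..n}. 2 * s * EE {1..n} (deriv j F)) = total_influence n p f"
      unfolding total_influence_def F_def by (intro sum.cong refl) (simp only: influence_eq[OF _ assms(4)])
    then have "(\<Sum>j\<in>{1..n}. 2 * s * EE {1..n} (deriv j F)) \<le> of_int \<lceil>total_influence n p f\<rceil>" by simp
    moreover have "\<alpha> = EE {1..n} F" unfolding F_def assms(5) by (rule expectation_mu)
    moreover have "F X \<le> F Y" if "X \<subseteq> Y" "Y \<subseteq> {1..n}" for X Y
      using mono_char_fun[OF assms(4) that] by (auto simp: F_def)
    moreover have "F X = 0 \<or> F X = 1" for X by (simp add: F_def)
    ultimately obtain S where S: "S \<subseteq> {1..n}"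
      "real (card S) \<le> exp (10 ^ 12 * (real_of_int \<lceil>total_influence n p f\<rceil> / (\<alpha> * \<epsilon>))\<^sup>2)"
      "1 - \<epsilon> \<le> EE {1..n} (\<lambda>X. F (X \<union> S))"
      using bounded_dense_link[of "{1..n}" F \<alpha> \<epsilon> "\<lceil>total_influence n p f\<rceil>"] assms(6,7) True by auto
    have "(real_of_int \<lceil>total_influence n p f\<rceil> / (\<alpha> * \<epsilon>))\<^sup>2 =
        (real_of_int \<lceil>total_influence n p f\<rceil>)\<^sup>2 * \<alpha> powi (-2) * \<epsilon> powi (-2)"
      by (simp add: power_int_minus power_divide power_mult_distrib divide_inverse power_inverse)
    then show ?thesis using S cond[OF S(1)] by (intro exI[of _ S]) (simp add: mult.assoc)
  qed
qed

end
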